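(* Let $\langle W,R\rangle$ be a modal frame with $W$ a non-empty countable set and $R$ reflexive and transitive (an $\mathsf{S4}$ frame). Fix $w_0\in W$, let $G=\mathrm{Stab}_{w_0}$ be the stabilizer of $w_0$ in the automorphism group of the frame, let $\mathcal{R}^{\mathrm{cl}}(w_0)=\{w\in W:R(w_0,w)\}$, and let $\mathcal{O}$ be the set of $G$-orbits in $\mathcal{R}^{\mathrm{cl}}(w_0)$. Let $L$ be a finite set of atoms, $\Omega=(\{0,1\}^L)^W$ with product $\sigma$-field $\mathcal{F}$, $V$ the coordinate valuation, and $P$ a probability measure on $(\Omega,\mathcal{F})$ modally exchangeable at $w_0$. Let $\mathcal{F}^G$ be the $G$-invariant $\sigma$-field and $\Xi$ an $\mathcal{F}^G$-measurable random variable giving the ergodic decomposition of $P$ (so $P=\int P(\cdot\mid\Xi=\xi)\,P_\Xi(d\xi)$ with each $P(\cdot\mid\Xi=\xi)$ $G$-ergodic). Assume that for each orbit $O\in\mathcal{O}$ the restricted action of $G$ on $O$ has property (Ext): for any finite pairwise-disjoint subsets $F_1,\dots,F_m\subseteq O$ and $F'_1,\dots,F'_m\subseteq O$ with $|F_i|=|F'_i|$ for all $i$, there is $\pi\in G$ with $\pi(F_i)=F'_i$ for all $i$. Then there exist random probability measures $\{\Lambda_O:O\in\mathcal{O}\}$ on $\{0,1\}^L$ such that: (1) (Within-orbit i.i.d.) for each $O\in\mathcal{O}$, conditional on $\Lambda_O$, the valuations $\{V(w)\}_{w\in O}$ are i.i.d. with law $\Lambda_O$; (2) (Cross-orbit structure)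 conditional on $\mathcal{F}^G$ (equivalently, on $\Xi$), for each orbit $O$ the restriction $V|_O$ is i.i.d. within $O$ with directing law $\Lambda_O(\Xi)$; cross-orbit dependence is not ruled out by $G$-invariance and may be mediated through $\Xi$, i.e. through the joint distribution of $\{\Lambda_O\}_{O\in\mathcal{O}}$; (3) (Rigidity) each $\Lambda_O$ is $\mathcal{F}^G$-measurable: for any $\pi\in G$ with $\pi(O)=O$, $\Lambda_O(\pi\cdot V)=\Lambda_O(V)$ $P$-a.s.; in particular $\Lambda_O$ does not depend on the choice of world within $O$.
   Context: An automorphism of $\langle W,R\rangle$ is a bijection $\pi:W\to W$ with $R(w,v)\iff R(\pi(w),\pi(v))$ for all $w,v$. The stabilizer is $G=\{\pi\in\mathrm{Aut}\langle W,R\rangle:\pi(w_0)=w_0\}$; it permutes $\mathcal{R}^{\mathrm{cl}}(w_0)$. The $G$-orbits in $\mathcal{R}^{\mathrm{cl}}(w_0)$ are the classes of $v\sim v'\iff\exists\pi\in G:\pi(v)=v'$. A valuation is a function $V:W\to\{0,1\}^L$; $\Omega=(\{0,1\}^L)^W$ carries the product $\sigma$-field $\mathcal{F}$ and $V$ is the coordinate random element. The action on valuations is $(\pi\cdot V)(w)=V(\pi^{-1}(w))$. $P$ is modally exchangeable at $w_0$ if $P(\pi^{-1}(A))=P(A)$ for all $\pi\in G$, $A\in\mathcal{F}$. The $G$-invariant $\sigma$-field is $\mathcal{F}^G=\{A\in\mathcal{F}:\pi^{-1}(A)=A\ \forall\pi\in G\}$. A $G$-invariant probability measure is $G$-ergodic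 if every $G$-invariant event has probability $0$ or $1$.
   Formalization: F^G may be any σ-field between the strictly and the P-a.s. invariant events, and ergodicity is tested on events invariant up to null sets; the i.i.d. claims in (1) and (2) are made only for orbits that are infinite or have one world. The literal claims fail otherwise. *)

theory Defs
  imports "HOL-Probability.Probability"
begin

text \<open>Worlds and atoms are elements of carrier sets \<open>W\<close> and \<open>L\<close>. A permutation of \<open>W\<close> is any
  function whose restriction to \<open>W\<close> is a bijection; its values off \<open>W\<close> are irrelevant.\<close>

definition frame_aut :: "'w set \<Rightarrow> ('w \<Rightarrow> 'w \<Rightarrow> bool) \<Rightarrow> ('w \<Rightarrow> 'w) set" where
  "frame_aut W R = {\<pi>. bij_betw \<pi> W W \<and> (\<forall>w\<in>W. \<forall>v\<in>W. R w v \<longleftrightarrow> R (\<pi> w) (\<pi> v))}"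

definition stab :: "'w set \<Rightarrow> ('w \<Rightarrow> 'w \<Rightarrow> bool) \<Rightarrow> 'w \<Rightarrow> ('w \<Rightarrow> 'w) set" where
  "stab W R w0 = {\<pi> \<in> frame_aut W R. \<pi> w0 = w0}"

definition accessible :: "'w set \<Rightarrow> ('w \<Rightarrow> 'w \<Rightarrow> bool) \<Rightarrow> 'w \<Rightarrow> 'w set" where
  "accessible W R w0 = {w \<in> W. R w0 w}"

definition orbits :: "'w set \<Rightarrow> ('w \<Rightarrow> 'w \<Rightarrow> bool) \<Rightarrow> 'w \<Rightarrow> 'w set set" where
  "orbits W R w0 = accessible W R w0 //
     {(v, v'). v \<in> accessible W R w0 \<and> v' \<in> accessible W R w0 \<and> (\<exists>\<pi>\<in>stab W R w0. \<pi> v = v')}"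

definition ext_property :: "('w \<Rightarrow> 'w) set \<Rightarrow> 'w set \<Rightarrow> bool" where
  "ext_property G X \<longleftrightarrow>
     (\<forall>(m::nat) F F'.
        (\<forall>i<m. finite (F i) \<and> F i \<subseteq> X \<and> finite (F' i) \<and> F' i \<subseteq> X \<and> card (F i) = card (F' i)) \<and>
        disjoint_family_on F {..<m} \<and> disjoint_family_on F' {..<m} \<longrightarrow>
        (\<exists>\<pi>\<in>G. \<forall>i<m. \<pi> ` F i = F' i))"

definition label_space :: "'l set \<Rightarrow> ('l \<Rightarrow> bool) measure" where
  "label_space L = count_space (L \<rightarrow>\<^sub>E UNIV)"

definition val_space :: "'w set \<Rightarrow> 'l set \<Rightarrow> ('w \<Rightarrow> 'l \<Rightarrow> bool) measure" where
  "val_space W L = PiM W (\<lambda>_. label_space L)"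

definition act :: "'w set \<Rightarrow> ('w \<Rightarrow> 'w) \<Rightarrow> ('w \<Rightarrow> 'a) \<Rightarrow> ('w \<Rightarrow> 'a)" where
  "act W \<pi> v = (\<lambda>w\<in>W. v (inv_into W \<pi> w))"

text \<open>With \<open>G\<close> the stabilizer of \<open>w0\<close>, this is modal exchangeability at \<open>w0\<close>.\<close>

definition invariant_measure :: "'w set \<Rightarrow> ('w \<Rightarrow> 'w) set \<Rightarrow> ('w \<Rightarrow> 'l \<Rightarrow> bool) measure \<Rightarrow> bool" where
  "invariant_measure W G P \<longleftrightarrow>
     (\<forall>\<pi>\<in>G. \<forall>A\<in>sets P. measure P (act W \<pi> -` A \<inter> space P) = measure P A)"

definition modally_exchangeable ::
  "'w set \<Rightarrow> ('w \<Rightarrow> 'w \<Rightarrow> bool) \<Rightarrow> 'w \<Rightarrow> ('w \<Rightarrow> 'l \<Rightarrow> bool) measure \<Rightarrow> bool" where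
  "modally_exchangeable W R w0 P \<longleftrightarrow> invariant_measure W (stab W R w0) P"

definition inv_field :: "'w set \<Rightarrow> 'l set \<Rightarrow> ('w \<Rightarrow> 'w) set \<Rightarrow> ('w \<Rightarrow> 'l \<Rightarrow> bool) measure" where
  "inv_field W L G = sigma (space (val_space W L))
     {A \<in> sets (val_space W L). \<forall>\<pi>\<in>G. act W \<pi> -` A \<inter> space (val_space W L) = A}"

definition ae_invariant ::
  "'w set \<Rightarrow> ('w \<Rightarrow> 'w) set \<Rightarrow> ('w \<Rightarrow> 'l \<Rightarrow> bool) measure \<Rightarrow> ('w \<Rightarrow> 'l \<Rightarrow> bool) set \<Rightarrow> bool" where
  "ae_invariant W G P A \<longleftrightarrow> (\<forall>\<pi>\<in>G. AE v in P. act W \<pi> v \<in> A \<longleftrightarrow> v \<in> A)"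

text \<open>The stabilizer may be uncountable, and then the strictly invariant field can be far smaller
  than the field of events invariant up to null sets: for all permutations of a countably infinite
  set, the strict field is trivial under every mixture of non-degenerate i.i.d. laws. Strict
  invariance is therefore too weak for an ergodic decomposition into i.i.d. laws. A version of the
  invariant field under \<open>P\<close> is any \<open>\<sigma>\<close>-field between the two, both included; ergodicity is stated
  for events invariant up to null sets of the measure in question.\<close>

definition inv_field_version ::
  "'w set \<Rightarrow> 'l set \<Rightarrow> ('w \<Rightarrow> 'w) set \<Rightarrow> ('w \<Rightarrow> 'l \<Rightarrow> bool) measure \<Rightarrow> ('w \<Rightarrow> 'l \<Rightarrow> bool) measure \<Rightarrow> bool"
  where "inv_field_version W L G P H \<longleftrightarrow>
     subalgebra P H \<and> sets (inv_field W L G) \<subseteq> sets H \<and> (\<forall>A\<in>sets H. ae_invariant W G P A)"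

definition ergodic_measure :: "'w set \<Rightarrow> ('w \<Rightarrow> 'w) set \<Rightarrow> ('w \<Rightarrow> 'l \<Rightarrow> bool) measure \<Rightarrow> bool" where
  "ergodic_measure W G P \<longleftrightarrow> prob_space P \<and> invariant_measure W G P \<and>
     (\<forall>A\<in>sets P. ae_invariant W G P A \<longrightarrow> measure P A = 0 \<or> measure P A = 1)"

text \<open>The kernel \<open>\<kappa>\<close> is the regular conditional law of \<open>V\<close> given \<open>\<Xi>\<close>.\<close>

definition ergodic_decomposition ::
  "'w set \<Rightarrow> 'l set \<Rightarrow> ('w \<Rightarrow> 'w) set \<Rightarrow> ('w \<Rightarrow> 'l \<Rightarrow> bool) measure \<Rightarrow> ('w \<Rightarrow> 'l \<Rightarrow> bool) measure \<Rightarrow>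
   'x measure \<Rightarrow> (('w \<Rightarrow> 'l \<Rightarrow> bool) \<Rightarrow> 'x) \<Rightarrow> ('x \<Rightarrow> ('w \<Rightarrow> 'l \<Rightarrow> bool) measure) \<Rightarrow> bool" where
  "ergodic_decomposition W L G P H E \<Xi> \<kappa> \<longleftrightarrow>
     \<Xi> \<in> measurable H E \<and>
     \<kappa> \<in> measurable E (prob_algebra (val_space W L)) \<and>
     (\<forall>A\<in>sets P. \<forall>B\<in>sets E.
        emeasure P (A \<inter> (\<Xi> -` B \<inter> space P)) = (\<integral>\<^sup>+ \<xi>\<in>B. emeasure (\<kappa> \<xi>) A \<partial>distr P E \<Xi>)) \<and>
     (AE \<xi> in distr P E \<Xi>. ergodic_measure W G (\<kappa> \<xi>))"

definition generated_field :: "'a measure \<Rightarrow> ('a \<Rightarrow> 'b) \<Rightarrow> 'b measure \<Rightarrow> 'a measure" where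
  "generated_field P X N = vimage_algebra (space P) X N"

definition cond_iid ::
  "('w \<Rightarrow> 'a) measure \<Rightarrow> ('w \<Rightarrow> 'a) measure \<Rightarrow> 'a measure \<Rightarrow> 'w set \<Rightarrow>
   (('w \<Rightarrow> 'a) \<Rightarrow> 'a measure) \<Rightarrow> bool" where
  "cond_iid P H S X \<Lambda> \<longleftrightarrow>
     (\<forall>J B. finite J \<and> J \<subseteq> X \<and> (\<forall>w\<in>J. B w \<in> sets S) \<longrightarrow>
        (AE v in P. real_cond_exp P H (indicator {v \<in> space P. \<forall>w\<in>J. v w \<in> B w}) v =
           (\<Prod>w\<in>J. measure (\<Lambda> v) (B w))))"

lemma space_label_space: "space (label_space L) = (L \<rightarrow>\<^sub>E UNIV)"
  by (simp add: label_space_def)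

lemma space_val_space: "space (val_space W L) = (W \<rightarrow>\<^sub>E (L \<rightarrow>\<^sub>E UNIV))"
  by (simp add: val_space_def label_space_def space_PiM)

lemma act_in_space:
  assumes "bij_betw \<pi> W W" "v \<in> space (val_space W L)"
  shows "act W \<pi> v \<in> space (val_space W L)"
proof -
  have "inv_into W \<pi> w \<in> W" if "w \<in> W" for w
    using assms(1) that by (metis bij_betw_def inv_into_into)
  then show ?thesis
    using assms(2) by (auto simp: act_def space_val_space PiE_iff)
qed

lemma space_inv_field: "space (inv_field W L G) = space (val_space W L)"
  unfolding inv_field_def by (rule space_measure_of) (auto dest: sets.sets_into_space)

lemma sets_inv_field:
  assumes "\<And>\<pi>. \<pi> \<in> G \<Longrightarrow> bij_betw \<pi> W W"
  shows "sets (inv_field W L G) =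
    {A \<in> sets (val_space W L). \<forall>\<pi>\<in>G. act W \<pi> -` A \<inter> space (val_space W L) = A}"
    (is "_ = ?S")
proof -
  let ?\<Omega> = "space (val_space W L)"
  have "sigma_algebra ?\<Omega> ?S"
    unfolding sigma_algebra_iff2
  proof (intro conjI ballI allI impI)
    show "?S \<subseteq> Pow ?\<Omega>" by (auto dest: sets.sets_into_space)
    show "{} \<in> ?S" by auto
  next
    fix s assume s: "s \<in> ?S"
    have "act W \<pi> -` (?\<Omega> - s) \<inter> ?\<Omega> = ?\<Omega> - (act W \<pi> -` s \<inter> ?\<Omega>)" if "\<pi> \<in> G" for \<pi>
      using act_in_space[OF assms[OF that]] by blast
    with s show "?\<Omega> - s \<in> ?S" by (auto intro: sets.compl_sets)
  next
    fix A :: "nat \<Rightarrow> _" assume A: "range A \<subseteq> ?S"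
    have "A i \<in> sets (val_space W L)" for i using A by blast
    then have 1: "\<Union>(range A) \<in> sets (val_space W L)" by (intro sets.countable_UN) blast
    have "act W \<pi> -` \<Union>(range A) \<inter> ?\<Omega> = \<Union>(range A)" if "\<pi> \<in> G" for \<pi>
    proof -
      have "act W \<pi> -` \<Union>(range A) \<inter> ?\<Omega> = (\<Union>i. act W \<pi> -` A i \<inter> ?\<Omega>)" by blast
      also have "\<dots> = (\<Union>i. A i)"
      proof (rule SUP_cong)
        fix i have "A i \<in> ?S" using A by blast
        with that show "act W \<pi> -` A i \<inter> ?\<Omega> = A i" by simp
      qed simp
      finally show ?thesis .
    qed
    with 1 show "\<Union>(range A) \<in> ?S" by simp
  qed
  then show ?thesis
    unfolding inv_field_def
    by (simp add: sigma_algebra.sets_measure_of_eq)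
qed

lemma inv_field_version_inv_field:
  assumes "\<And>\<pi>. \<pi> \<in> G \<Longrightarrow> bij_betw \<pi> W W" and "sets P = sets (val_space W L)"
  shows "inv_field_version W L G P (inv_field W L G)"
proof -
  have sp: "space P = space (val_space W L)"
    using assms(2) by (rule sets_eq_imp_space_eq)
  have S: "sets (inv_field W L G) =
      {A \<in> sets (val_space W L). \<forall>\<pi>\<in>G. act W \<pi> -` A \<inter> space (val_space W L) = A}"
    using assms(1) by (rule sets_inv_field)
  have "act W \<pi> v \<in> A \<longleftrightarrow> v \<in> A"
    if "\<pi> \<in> G" "A \<in> sets (inv_field W L G)" "v \<in> space P" for \<pi> A v
    using that unfolding S sp by blast
  then have "\<forall>A\<in>sets (inv_field W L G). ae_invariant W G P A"
    unfolding ae_invariant_def by (intro ballI AE_I2) simp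
  moreover have "subalgebra P (inv_field W L G)"
    unfolding subalgebra_def space_inv_field sp S assms(2) by blast
  ultimately show ?thesis
    unfolding inv_field_version_def by simp
qed

end

theory Submission
  imports Defs "HOL-Real_Asymp.Real_Asymp"
begin

text \<open>Fix an orbit \<open>X\<close> and a set \<open>B\<close> of labels. Under a \<open>G\<close>-invariant law, (Ext) makes
  \<open>P(V(x) \<in> B, V(y) \<in> B)\<close> the same for all \<open>x \<noteq> y\<close> in \<open>X\<close>, so two averages of the indicators of
  \<open>V(x) \<in> B\<close> over large finite subsets of \<open>X\<close> are close in \<open>L\<^sup>2\<close>. Hence they converge to a
  limit that is invariant up to null sets. Under an ergodic law the limit is the constant
  \<open>P(V(x) \<in> B)\<close>; so, given \<open>\<Xi>\<close>, the averages converge to \<open>\<Lambda>(\<Xi>)(B)\<close>, the one-world marginal of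
  \<open>\<kappa>(\<Xi>)\<close>.

  An event of \<open>H\<close> is \<open>P\<close>-invariant up to null sets, but need not be so under almost every
  \<open>\<kappa>(\<xi>)\<close>, because \<open>G\<close> may be uncountable. So the argument returns to \<open>P\<close>: for \<open>H\<close>-measurable \<open>h\<close> and
  finite \<open>J \<subseteq> X\<close>, an element of \<open>G\<close> that fixes \<open>J\<close> pointwise and moves \<open>x\<close> to \<open>y\<close> shows that
  \<open>E[h \<Prod>\<^sub>j 1(V(j) \<in> B\<^sub>j) 1(V(x) \<in> B)]\<close> does not depend on \<open>x \<in> X - J\<close>; averaging over \<open>x\<close> replaces the
  last factor by \<open>\<Lambda>(\<Xi>)(B)\<close>, and the factors are removed one at a time.

  Dependence between orbits is realised by the fair mixture of two constant valuations.\<close>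

section \<open>Stabilizers and orbits\<close>

lemma stab_bij: "\<pi> \<in> stab W R w0 \<Longrightarrow> bij_betw \<pi> W W"
  by (simp add: stab_def frame_aut_def)

lemma stab_R: "\<pi> \<in> stab W R w0 \<Longrightarrow> w \<in> W \<Longrightarrow> v \<in> W \<Longrightarrow> R (\<pi> w) (\<pi> v) \<longleftrightarrow> R w v"
  by (simp add: stab_def frame_aut_def)

lemma stab_fix: "\<pi> \<in> stab W R w0 \<Longrightarrow> \<pi> w0 = w0"
  by (simp add: stab_def)

lemma stab_in: "\<pi> \<in> stab W R w0 \<Longrightarrow> w \<in> W \<Longrightarrow> \<pi> w \<in> W"
  using stab_bij by (fastforce simp: bij_betw_def)

lemma stabI:
  assumes "bij_betw \<pi> W W" "\<And>w v. w \<in> W \<Longrightarrow> v \<in> W \<Longrightarrow> R (\<pi> w) (\<pi> v) \<longleftrightarrow> R w v" "\<pi> w0 = w0"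
  shows "\<pi> \<in> stab W R w0"
  using assms by (simp add: stab_def frame_aut_def)

lemma stab_comp:
  assumes "\<pi> \<in> stab W R w0" "\<rho> \<in> stab W R w0"
  shows "\<rho> \<circ> \<pi> \<in> stab W R w0"
  using assms
  by (intro stabI) (auto simp: stab_R stab_fix stab_in intro: bij_betw_trans stab_bij)

lemma stab_inv_into:
  assumes \<pi>: "\<pi> \<in> stab W R w0" and w0: "w0 \<in> W"
  shows "inv_into W \<pi> \<in> stab W R w0"
proof -
  have b: "bij_betw \<pi> W W" by (rule stab_bij[OF \<pi>])
  have iW: "inv_into W \<pi> w \<in> W" if "w \<in> W" for w
    using b that by (metis bij_betw_def inv_into_into)
  have i: "\<pi> (inv_into W \<pi> w) = w" if "w \<in> W" for w
    using b that by (metis bij_betw_inv_into_right)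
  show ?thesis
  proof (rule stabI)
    show "bij_betw (inv_into W \<pi>) W W" by (rule bij_betw_inv_into[OF b])
    show "inv_into W \<pi> w0 = w0"
      using stab_fix[OF \<pi>] b w0 by (metis bij_betw_inv_into_left)
    fix w v assume "w \<in> W" "v \<in> W"
    then show "R (inv_into W \<pi> w) (inv_into W \<pi> v) \<longleftrightarrow> R w v"
      using stab_R[OF \<pi> iW iW] i by metis
  qed
qed

lemma stab_accessible:
  assumes "\<pi> \<in> stab W R w0" "w0 \<in> W" "v \<in> accessible W R w0"
  shows "\<pi> v \<in> accessible W R w0"
  using assms(3) stab_R[OF assms(1,2), of v] stab_fix[OF assms(1)] stab_in[OF assms(1)]
  by (simp add: accessible_def)

lemma orbitsE:
  assumes "X \<in> orbits W R w0"
  obtains x where "x \<in> accessible W R w0"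
    "X = {y \<in> accessible W R w0. \<exists>\<pi>\<in>stab W R w0. \<pi> x = y}"
  using assms unfolding orbits_def by (auto elim!: quotientE)

lemma id_in_stab: "id \<in> stab W R w0"
  by (simp add: stab_def frame_aut_def)

lemma orbits_subset: "X \<in> orbits W R w0 \<Longrightarrow> X \<subseteq> W"
  by (auto elim!: orbitsE simp: accessible_def)

lemma orbits_nonempty: "X \<in> orbits W R w0 \<Longrightarrow> X \<noteq> {}"
  using id_in_stab by (force elim!: orbitsE)

text \<open>One inclusion, valid for every \<open>\<rho>\<close> in the stabilizer, comes from
  composing \<open>\<rho>\<close> with the element that reaches a point of \<open>X\<close> from the
  base point of the orbit. Applied to the inverse of \<open>\<pi>\<close>, it yields the other
  inclusion.\<close>

lemma orbits_image:
  assumes "X \<in> orbits W R w0" "w0 \<in> W" "\<pi> \<in> stab W R w0"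
  shows "\<pi> ` X = X"
proof -
  have sub: "\<rho> ` X \<subseteq> X" if "\<rho> \<in> stab W R w0" for \<rho>
    using assms(1)
  proof (rule orbitsE)
    fix x assume x: "X = {y \<in> accessible W R w0. \<exists>\<pi>\<in>stab W R w0. \<pi> x = y}"
    show ?thesis
    proof
      fix z assume "z \<in> \<rho> ` X"
      then obtain \<sigma> where \<sigma>: "\<sigma> \<in> stab W R w0" "\<sigma> x \<in> accessible W R w0" "z = (\<rho> \<circ> \<sigma>) x"
        using x by auto
      then show "z \<in> X"
        using x stab_comp[OF \<sigma>(1) that] stab_accessible[OF that assms(2) \<sigma>(2)]
        by (auto intro!: bexI[of _ "\<rho> \<circ> \<sigma>"])
    qed
  qed
  have "X \<subseteq> \<pi> ` X"
  proof
    fix y assume y: "y \<in> X"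
    then have "inv_into W \<pi> y \<in> X"
      using sub[OF stab_inv_into[OF assms(3,2)]] by blast
    moreover have "\<pi> (inv_into W \<pi> y) = y"
      using stab_bij[OF assms(3)] y orbits_subset[OF assms(1)] by (metis bij_betw_inv_into_right subsetD)
    ultimately show "y \<in> \<pi> ` X" by (metis imageI)
  qed
  with sub[OF assms(3)] show ?thesis by blast
qed

text \<open>(Ext) speaks of images of sets; applied to singletons it prescribes the value of
  \<open>\<pi>\<close> at each point of \<open>J\<close>. Every later use of (Ext) goes through this
  form, with \<open>\<phi>\<close> moving one or two worlds and possibly fixing others.\<close>

lemma ext_property_extends:
  assumes ext: "ext_property G X" and J: "finite J" "J \<subseteq> X" and \<phi>: "inj_on \<phi> J" "\<phi> ` J \<subseteq> X"
  shows "\<exists>\<pi>\<in>G. \<forall>j\<in>J. \<pi> j = \<phi> j"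
proof -
  obtain e where e: "bij_betw e {0..<card J} J"
    using ex_bij_betw_nat_finite[OF J(1)] by blast
  have eJ: "e i \<in> J" if "i < card J" for i using e that by (auto simp: bij_betw_def)
  have inj: "i = k" if "i < card J" "k < card J" "e i = e k" for i k
    using e that by (auto simp: bij_betw_def inj_on_def)
  have "disjoint_family_on (\<lambda>i. {e i}) {..<card J}"
    using inj by (auto simp: disjoint_family_on_def)
  moreover have "disjoint_family_on (\<lambda>i. {\<phi> (e i)}) {..<card J}"
    using inj eJ \<phi>(1) by (auto simp: disjoint_family_on_def inj_on_def)
  moreover have "\<forall>i<card J. finite {e i} \<and> {e i} \<subseteq> X \<and> finite {\<phi> (e i)} \<and> {\<phi> (e i)} \<subseteq> X
      \<and> card {e i} = card {\<phi> (e i)}"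
    using eJ J(2) \<phi>(2) by auto
  ultimately obtain \<pi> where \<pi>: "\<pi> \<in> G" "\<forall>i<card J. \<pi> ` {e i} = {\<phi> (e i)}"
    using ext[unfolded ext_property_def, rule_format, of "card J" "\<lambda>i. {e i}" "\<lambda>i. {\<phi> (e i)}"]
    by blast
  have "\<pi> j = \<phi> j" if "j \<in> J" for j
  proof -
    have "j \<in> e ` {0..<card J}" using e that by (simp add: bij_betw_def)
    then obtain i where "i < card J" "j = e i" by auto
    with \<pi>(2) show ?thesis by auto
  qed
  with \<pi>(1) show ?thesis by blast
qed

section \<open>Averages over an orbit under an invariant law\<close>

lemma measurable_act:
  assumes "bij_betw \<pi> W W"
  shows "act W \<pi> \<in> measurable (val_space W L) (val_space W L)"
proof -
  have "inv_into W \<pi> w \<in> W" if "w \<in> W" for w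
    using assms that by (metis bij_betw_def inv_into_into)
  then show ?thesis
    unfolding act_def val_space_def by (intro measurable_restrict measurable_component_singleton)
qed

lemma act_apply:
  assumes "bij_betw \<pi> W W" "a \<in> W"
  shows "act W \<pi> v (\<pi> a) = v a"
  using assms by (auto simp: act_def bij_betw_def)

text \<open>Put the off-diagonal value \<open>q\<close> everywhere and correct the diagonal by
  \<open>p - q\<close>. The right-hand side isolates the total weight: weights summing to 0 lose the
  \<open>q\<close> term, and constant weights give the second moment of an average.\<close>

lemma sum_pairs:
  fixes c :: "'i \<Rightarrow> real"
  assumes "finite U"
  shows "(\<Sum>x\<in>U. \<Sum>y\<in>U. c x * c y * (if x = y then p else q)) =
    q * (\<Sum>x\<in>U. c x)\<^sup>2 + (p - q) * (\<Sum>x\<in>U. (c x)\<^sup>2)"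
proof -
  have "(\<Sum>x\<in>U. \<Sum>y\<in>U. c x * c y * (if x = y then p else q)) =
     (\<Sum>x\<in>U. \<Sum>y\<in>U. q * (c x * c y) + (if x = y then (p - q) * (c x)\<^sup>2 else 0))"
    by (intro sum.cong refl) (auto simp: power2_eq_square algebra_simps)
  also have "\<dots> = q * (\<Sum>x\<in>U. c x)\<^sup>2 + (p - q) * (\<Sum>x\<in>U. (c x)\<^sup>2)"
    using assms by (simp add: sum.distrib power2_eq_square sum_product)
      (simp add: sum_distrib_left)
  finally show ?thesis .
qed

text \<open>This is nonnegativity of the variance of \<open>\<bar>f\<bar>\<close>. It turns
  second-moment bounds into L1 bounds.\<close>

lemma (in prob_space) expectation_abs_le_sqrt:
  fixes f :: "'a \<Rightarrow> real"
  assumes "integrable M f" "integrable M (\<lambda>x. (f x)\<^sup>2)"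
  shows "expectation (\<lambda>x. \<bar>f x\<bar>) \<le> sqrt (expectation (\<lambda>x. (f x)\<^sup>2))"
proof -
  have "0 \<le> variance (\<lambda>x. \<bar>f x\<bar>)" by (rule variance_positive)
  also have "\<dots> = expectation (\<lambda>x. (f x)\<^sup>2) - (expectation (\<lambda>x. \<bar>f x\<bar>))\<^sup>2"
    using assms by (subst variance_eq) auto
  finally show ?thesis by (intro real_le_rsqrt) simp
qed

text \<open>The assumptions isolate what \<open>P\<close> shares with the ergodic kernel laws
  \<open>\<kappa> \<xi>\<close>, so that the moment computations apply to both. The group enters
  only as a set \<open>G\<close> of permutations of \<open>W\<close> that preserve
  \<open>X\<close>.\<close>

locale orbit_law = prob_space P
  for P :: "('w \<Rightarrow> 'l \<Rightarrow> bool) measure" +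
  fixes W :: "'w set" and L :: "'l set" and G :: "('w \<Rightarrow> 'w) set" and X :: "'w set"
  assumes sets_P: "sets P = sets (val_space W L)"
    and bij: "\<pi> \<in> G \<Longrightarrow> bij_betw \<pi> W W"
    and invariant: "invariant_measure W G P"
    and X_sub: "X \<subseteq> W"
    and X_image: "\<pi> \<in> G \<Longrightarrow> \<pi> ` X = X"
    and ext: "ext_property G X"
begin

lemma space_P: "space P = space (val_space W L)"
  by (rule sets_eq_imp_space_eq[OF sets_P])

lemma act_measurable: "\<pi> \<in> G \<Longrightarrow> act W \<pi> \<in> measurable P P"
  using measurable_act[OF bij] measurable_cong_sets[OF sets_P sets_P] by auto

lemma distr_act:
  assumes "\<pi> \<in> G"
  shows "distr P P (act W \<pi>) = P"
proof (rule measure_eqI)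
  fix A assume A: "A \<in> sets (distr P P (act W \<pi>))"
  then have "emeasure (distr P P (act W \<pi>)) A = emeasure P (act W \<pi> -` A \<inter> space P)"
    by (intro emeasure_distr act_measurable assms) simp
  also have "\<dots> = emeasure P A"
    using invariant assms A by (simp add: invariant_measure_def emeasure_eq_measure)
  finally show "emeasure (distr P P (act W \<pi>)) A = emeasure P A" .
qed simp

lemma integral_act:
  fixes F :: "_ \<Rightarrow> real"
  assumes "\<pi> \<in> G" "F \<in> borel_measurable P"
  shows "(\<integral>v. F (act W \<pi> v) \<partial>P) = (\<integral>v. F v \<partial>P)"
  using integral_distr[OF act_measurable[OF assms(1)] assms(2)] distr_act[OF assms(1)] by simp

lemma AE_act:
  assumes "\<pi> \<in> G" "AE v in P. Q v"
  shows "AE v in P. Q (act W \<pi> v)"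
  by (rule AE_distrD[OF act_measurable[OF assms(1)]]) (subst distr_act[OF assms(1)], rule assms(2))

definition hit :: "('l \<Rightarrow> bool) set \<Rightarrow> 'w \<Rightarrow> ('w \<Rightarrow> 'l \<Rightarrow> bool) \<Rightarrow> real" where
  "hit B x v = indicator B (v x)"

definition avg :: "('l \<Rightarrow> bool) set \<Rightarrow> 'w set \<Rightarrow> ('w \<Rightarrow> 'l \<Rightarrow> bool) \<Rightarrow> real" where
  "avg B S v = (\<Sum>x\<in>S. hit B x v) / card S"

lemma hit_measurable:
  assumes "x \<in> W" "B \<in> sets (label_space L)"
  shows "hit B x \<in> borel_measurable P"
proof -
  have 1: "(\<lambda>v. v x) \<in> measurable (val_space W L) (label_space L)"
    unfolding val_space_def by (rule measurable_component_singleton[OF assms(1)])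
  have "hit B x \<in> borel_measurable (val_space W L)"
    unfolding hit_def by (rule measurable_compose[OF 1]) (rule borel_measurable_indicator[OF assms(2)])
  then show ?thesis using measurable_cong_sets[OF sets_P refl] by blast
qed

lemma hit_01: "0 \<le> hit B x v" "hit B x v \<le> 1"
  by (auto simp: hit_def indicator_def)

lemma avg_measurable:
  assumes "S \<subseteq> W" "B \<in> sets (label_space L)"
  shows "avg B S \<in> borel_measurable P"
proof -
  have "(\<lambda>v. \<Sum>x\<in>S. hit B x v) \<in> borel_measurable P"
    using assms by (intro borel_measurable_sum hit_measurable) auto
  then show ?thesis unfolding avg_def by simp
qed

lemma avg_01: "0 \<le> avg B S v" "avg B S v \<le> 1"
proof -
  show "0 \<le> avg B S v" unfolding avg_def by (intro divide_nonneg_nonneg sum_nonneg hit_01) simp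
  have "(\<Sum>x\<in>S. hit B x v) \<le> (\<Sum>x\<in>S. 1)" by (intro sum_mono hit_01)
  \<comment> \<open>The case \<open>card S = 0\<close> rests on division by zero giving
    zero.\<close>
  then show "avg B S v \<le> 1" unfolding avg_def by (cases "card S = 0") (simp_all add: divide_le_eq_1)
qed

lemma integrable_bounded:
  fixes f :: "_ \<Rightarrow> real"
  assumes "f \<in> borel_measurable P" "\<And>v. \<bar>f v\<bar> \<le> c"
  shows "integrable P f"
  using assms by (intro integrable_const_bound[where B=c]) auto

text \<open>Translating an average by \<open>\<pi>\<close> gives an average over another set of the
  same size inside \<open>X\<close>, so bounds comparing two averages also control the effect of
  \<open>\<pi>\<close>.\<close>

lemma avg_act:
  assumes "\<pi> \<in> G" "S \<subseteq> X"
  shows "inv_into W \<pi> ` S \<subseteq> X" "card (inv_into W \<pi> ` S) = card S"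
    "avg B S (act W \<pi> v) = avg B (inv_into W \<pi> ` S) v"
proof -
  have b: "bij_betw \<pi> W W" by (rule bij[OF assms(1)])
  have SW: "S \<subseteq> W" using assms(2) X_sub by auto
  show "inv_into W \<pi> ` S \<subseteq> X"
  proof
    fix y assume "y \<in> inv_into W \<pi> ` S"
    then obtain s where s: "s \<in> S" "y = inv_into W \<pi> s" by auto
    obtain t where t: "t \<in> X" "s = \<pi> t" using X_image[OF assms(1)] s(1) assms(2) by blast
    then have "y = t" using s(2) b X_sub by (metis bij_betw_inv_into_left subsetD)
    with t show "y \<in> X" by simp
  qed
  have inj: "inj_on (inv_into W \<pi>) S"
    using bij_betw_inv_into[OF b] SW by (meson bij_betw_def inj_on_subset)
  show c: "card (inv_into W \<pi> ` S) = card S" by (rule card_image[OF inj])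
  have "(\<Sum>x\<in>S. hit B x (act W \<pi> v)) = (\<Sum>x\<in>inv_into W \<pi> ` S. hit B x v)"
    using SW by (subst sum.reindex[OF inj]) (auto intro!: sum.cong simp: hit_def act_def)
  then show "avg B S (act W \<pi> v) = avg B (inv_into W \<pi> ` S) v"
    by (simp add: avg_def c)
qed

section \<open>First and second moments of the averages\<close>

lemma expectation_hit_eq:
  assumes "x \<in> X" "y \<in> X" "B \<in> sets (label_space L)"
  shows "expectation (hit B x) = expectation (hit B y)"
proof -
  obtain \<pi> where \<pi>: "\<pi> \<in> G" "\<pi> x = y"
    using ext_property_extends[OF ext, of "{x}" "\<lambda>_. y"] assms by auto
  have "hit B y (act W \<pi> v) = hit B x v" for v
    using act_apply[OF bij[OF \<pi>(1)], of x v] \<pi>(2) X_sub assms(1) by (auto simp: hit_def)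
  then show ?thesis
    using integral_act[OF \<pi>(1) hit_measurable[of y B]] assms X_sub by auto
qed

text \<open>By (Ext) on two-point sets, \<open>G\<close> acts transitively on ordered pairs of
  distinct worlds of \<open>X\<close>, so there is a single off-diagonal second moment.\<close>

lemma expectation_hit2_eq:
  assumes "x \<in> X" "y \<in> X" "x \<noteq> y" "x' \<in> X" "y' \<in> X" "x' \<noteq> y'" "B \<in> sets (label_space L)"
  shows "expectation (\<lambda>v. hit B x v * hit B y v) = expectation (\<lambda>v. hit B x' v * hit B y' v)"
proof -
  obtain \<pi> where \<pi>: "\<pi> \<in> G" "\<pi> x = x'" "\<pi> y = y'"
    using ext_property_extends[OF ext, of "{x,y}" "\<lambda>z. if z = x then x' else y'"] assms by auto
  have "hit B x' (act W \<pi> v) = hit B x v" "hit B y' (act W \<pi> v) = hit B y v" for v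
    using act_apply[OF bij[OF \<pi>(1)], of x v] act_apply[OF bij[OF \<pi>(1)], of y v]
      \<pi> X_sub assms by (auto simp: hit_def)
  moreover have "(\<lambda>v. hit B x' v * hit B y' v) \<in> borel_measurable P"
    using assms X_sub by (intro borel_measurable_times hit_measurable) auto
  ultimately show ?thesis
    using integral_act[OF \<pi>(1), of "\<lambda>v. hit B x' v * hit B y' v"] by simp
qed

lemma expectation_quadratic:
  assumes "finite U" "U \<subseteq> X" "B \<in> sets (label_space L)"
  shows "expectation (\<lambda>v. (\<Sum>x\<in>U. c x * hit B x v)\<^sup>2) =
    (\<Sum>x\<in>U. \<Sum>y\<in>U. c x * c y * expectation (\<lambda>v. hit B x v * hit B y v))"
proof -
  have int: "integrable P (\<lambda>v. c x * c y * (hit B x v * hit B y v))" if "x \<in> U" "y \<in> U" for x y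
  proof (intro integrable_mult_right integrable_bounded[where c=1])
    show "(\<lambda>v. hit B x v * hit B y v) \<in> borel_measurable P"
      using that assms X_sub by (intro borel_measurable_times hit_measurable) auto
  qed (auto simp: hit_def indicator_def)
  have "expectation (\<lambda>v. (\<Sum>x\<in>U. c x * hit B x v)\<^sup>2) =
      expectation (\<lambda>v. \<Sum>x\<in>U. \<Sum>y\<in>U. c x * c y * (hit B x v * hit B y v))"
    by (simp add: power2_eq_square sum_product mult_ac)
  also have "\<dots> = (\<Sum>x\<in>U. \<Sum>y\<in>U. expectation (\<lambda>v. c x * c y * (hit B x v * hit B y v)))"
    using int by (simp add: Bochner_Integration.integral_sum)
  finally show ?thesis by simp
qed

lemma avg_eq_sum: "avg B S v = (\<Sum>x\<in>S. 1 / card S * hit B x v)"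
  by (simp add: avg_def sum_divide_distrib)

lemma expectation_avg_sq:
  assumes "finite S" "S \<subseteq> X" "B \<in> sets (label_space L)"
  shows "expectation (\<lambda>v. (avg B S v)\<^sup>2) =
    (\<Sum>x\<in>S. \<Sum>y\<in>S. expectation (\<lambda>v. hit B x v * hit B y v)) / (card S)\<^sup>2"
  unfolding avg_eq_sum using expectation_quadratic[OF assms, of "\<lambda>_. 1 / card S"]
  by (simp add: sum_divide_distrib power2_eq_square)

lemma expectation_avg:
  assumes "finite S" "S \<noteq> {}" "S \<subseteq> X" "B \<in> sets (label_space L)" "x \<in> X"
  shows "expectation (avg B S) = expectation (hit B x)"
proof -
  have "expectation (avg B S) = (\<Sum>y\<in>S. expectation (hit B y)) / card S"
    unfolding avg_def using assms X_sub
    by (subst Bochner_Integration.integral_divide_zero, subst Bochner_Integration.integral_sum)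
      (auto intro!: integrable_bounded[where c=1] hit_measurable simp: hit_def indicator_def)
  also have "(\<Sum>y\<in>S. expectation (hit B y)) = (\<Sum>y\<in>S. expectation (hit B x))"
    using assms by (intro sum.cong expectation_hit_eq) auto
  finally show ?thesis using assms by simp
qed

lemma expectation_hit2:
  assumes "x \<in> X" "y \<in> X" "x \<noteq> y" "a \<in> X" "b \<in> X" "B \<in> sets (label_space L)"
  shows "expectation (\<lambda>v. hit B a v * hit B b v) =
    (if a = b then expectation (hit B x) else expectation (\<lambda>v. hit B x v * hit B y v))"
proof (cases "a = b")
  case True
  have "(\<lambda>v. hit B b v * hit B b v) = hit B b" by (auto simp: fun_eq_iff hit_def indicator_def)
  then show ?thesis using True expectation_hit_eq[of b x B] assms by simp
next
  case False
  then show ?thesis using expectation_hit2_eq[of a b x y B] assms by simp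
qed

text \<open>The difference is a linear combination of indicators whose coefficients sum to 0. With
  constant off-diagonal moments \<open>q\<close>, only \<open>p - q\<close> times the sum of squared
  coefficients survives, and that sum is small for large sets, even when they overlap.\<close>

lemma avg_diff_L2:
  assumes S: "finite S" "S \<noteq> {}" "S \<subseteq> X" and T: "finite T" "T \<noteq> {}" "T \<subseteq> X"
    and B: "B \<in> sets (label_space L)" and inf: "infinite X"
  shows "expectation (\<lambda>v. (avg B S v - avg B T v)\<^sup>2) \<le> 2 / card S + 2 / card T"
proof -
  obtain x y where xy: "x \<in> X" "y \<in> X" "x \<noteq> y"
  proof -
    obtain x where "x \<in> X" using inf by (metis ex_in_conv finite.emptyI)
    moreover obtain y where "y \<in> X - {x}"
      using infinite_remove[OF inf, of x] by (metis ex_in_conv finite.emptyI)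
    ultimately show ?thesis using that by blast
  qed
  define p q where "p = expectation (hit B x)" and "q = expectation (\<lambda>v. hit B x v * hit B y v)"
  \<comment> \<open>Extending the weights by 0 to \<open>U\<close> makes both averages sums over the
    same set, without assuming \<open>S\<close> and \<open>T\<close> disjoint.\<close>
  define a b where "a z = (if z \<in> S then 1 / real (card S) else 0)"
    and "b z = (if z \<in> T then 1 / real (card T) else 0)" for z
  define U where "U = S \<union> T"
  have U: "finite U" "U \<subseteq> X" using S T by (auto simp: U_def)
  have UI: "U \<inter> S = S" "U \<inter> T = T" by (auto simp: U_def)
  have d: "avg B S v - avg B T v = (\<Sum>z\<in>U. (a z - b z) * hit B z v)" for v
  proof -
    have "(\<Sum>z\<in>U. a z * hit B z v) = avg B S v"
      using U(1) unfolding avg_eq_sum a_def by (simp add: if_distrib[of "\<lambda>t. t * _"] sum.If_cases UI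
          cong: if_cong)
    moreover have "(\<Sum>z\<in>U. b z * hit B z v) = avg B T v"
      using U(1) unfolding avg_eq_sum b_def by (simp add: if_distrib[of "\<lambda>t. t * _"] sum.If_cases UI
          cong: if_cong)
    ultimately show ?thesis by (simp add: left_diff_distrib sum_subtractf)
  qed
  have ab: "(\<Sum>z\<in>U. a z) = 1" "(\<Sum>z\<in>U. b z) = 1"
    "(\<Sum>z\<in>U. (a z)\<^sup>2) = 1 / card S" "(\<Sum>z\<in>U. (b z)\<^sup>2) = 1 / card T"
    using U(1) S T unfolding a_def b_def
    by (simp_all add: if_distrib[of "\<lambda>t. t\<^sup>2"] sum.If_cases UI power_divide cong: if_cong)
      (simp_all add: power2_eq_square)
  have "expectation (\<lambda>v. (avg B S v - avg B T v)\<^sup>2) =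
     (\<Sum>z\<in>U. \<Sum>z'\<in>U. (a z - b z) * (a z' - b z') * expectation (\<lambda>v. hit B z v * hit B z' v))"
    unfolding d using expectation_quadratic[OF U B, of "\<lambda>z. a z - b z"] .
  also have "\<dots> = (\<Sum>z\<in>U. \<Sum>z'\<in>U. (a z - b z) * (a z' - b z') * (if z = z' then p else q))"
    unfolding p_def q_def using U(2) by (intro sum.cong refl) (subst expectation_hit2[OF xy _ _ B]; auto)
  \<comment> \<open>The weights \<open>a z - b z\<close> have total 0, which removes the
    \<open>q\<close> term of \<open>sum_pairs\<close>.\<close>
  also have "\<dots> = (p - q) * (\<Sum>z\<in>U. (a z - b z)\<^sup>2)"
    by (subst sum_pairs[OF U(1)]) (simp add: sum_subtractf ab)
  also have "\<dots> \<le> 1 * (\<Sum>z\<in>U. (a z - b z)\<^sup>2)"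
  proof (rule mult_right_mono)
    have "p \<le> 1" unfolding p_def using B xy X_sub
      by (intro integral_le_const integrable_bounded[where c=1] hit_measurable)
        (auto simp: hit_def indicator_def)
    moreover have "0 \<le> q" unfolding q_def by (intro integral_nonneg_AE) (simp add: hit_01)
    ultimately show "p - q \<le> 1" by simp
  qed (simp add: sum_nonneg)
  also have "\<dots> \<le> (\<Sum>z\<in>U. 2 * (a z)\<^sup>2 + 2 * (b z)\<^sup>2)"
  proof -
    have "(s - t)\<^sup>2 \<le> 2 * s\<^sup>2 + 2 * t\<^sup>2" for s t :: real
      using zero_le_power2[of "s + t"] unfolding power2_sum power2_diff by linarith
    then show ?thesis by (simp add: sum_mono)
  qed
  also have "\<dots> = 2 / card S + 2 / card T"
    by (simp add: sum.distrib sum_distrib_left[symmetric] ab)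
  finally show ?thesis .
qed

text \<open>L1 distance is what the extraction of an almost surely Cauchy subsequence and the
  invariance of its limit both use.\<close>

lemma avg_diff_L1:
  assumes S: "finite S" "S \<noteq> {}" "S \<subseteq> X" and T: "finite T" "T \<noteq> {}" "T \<subseteq> X"
    and B: "B \<in> sets (label_space L)" and inf: "infinite X"
  shows "expectation (\<lambda>v. \<bar>avg B S v - avg B T v\<bar>) \<le> sqrt (2 / card S + 2 / card T)"
proof -
  have m: "(\<lambda>v. avg B S v - avg B T v) \<in> borel_measurable P"
    using S T X_sub B by (intro borel_measurable_diff avg_measurable) auto
  have b: "\<bar>avg B S v - avg B T v\<bar> \<le> 1" for v
    using avg_01[of B S v] avg_01[of B T v] by auto
  have "expectation (\<lambda>v. \<bar>avg B S v - avg B T v\<bar>) \<le> sqrt (expectation (\<lambda>v. (avg B S v - avg B T v)\<^sup>2))"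
    using m b
    by (intro expectation_abs_le_sqrt integrable_bounded[where c=1] borel_measurable_power)
      (auto simp: abs_square_le_1 simp del: abs_power2 intro: power_le_one)
  also have "\<dots> \<le> sqrt (2 / card S + 2 / card T)"
    using avg_diff_L2[OF S T B inf] by simp
  finally show ?thesis .
qed

section \<open>Ergodic laws\<close>

text \<open>The event that \<open>Z\<close> exceeds its mean is invariant up to null sets, hence
  trivial. It cannot have probability 1, since the mean would then exceed itself. So
  \<open>Z\<close> is almost surely at most its mean, and a variable bounded by its own mean equals
  it almost surely.\<close>

lemma ergodic_invariant_const:
  fixes Z :: "_ \<Rightarrow> real"
  assumes erg: "ergodic_measure W G P" and Z: "Z \<in> borel_measurable P" "\<And>v. \<bar>Z v\<bar> \<le> c"
    and inv: "\<And>\<pi>. \<pi> \<in> G \<Longrightarrow> AE v in P. Z (act W \<pi> v) = Z v"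
  shows "AE v in P. Z v = expectation Z"
proof -
  let ?p = "expectation Z"
  define A where "A = {v \<in> space P. Z v > ?p}"
  have int: "integrable P Z" by (rule integrable_bounded[OF Z])
  have A: "A \<in> sets P" unfolding A_def using Z(1) by measurable
  have "ae_invariant W G P A"
    unfolding ae_invariant_def
  proof
    fix \<pi> assume \<pi>: "\<pi> \<in> G"
    show "AE v in P. (act W \<pi> v \<in> A) = (v \<in> A)"
      using inv[OF \<pi>] AE_space
      by eventually_elim (use measurable_space[OF act_measurable[OF \<pi>]] in \<open>auto simp: A_def\<close>)
  qed
  then have "prob A = 0 \<or> prob A = 1"
    using erg A by (simp add: ergodic_measure_def)
  moreover have "prob A \<noteq> 1"
  proof
    assume "prob A = 1"
    then have "AE v in P. v \<in> A" using A by (simp add: prob_eq_1)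
    then have "AE v in P. ?p < Z v" by eventually_elim (simp add: A_def)
    then have "expectation (\<lambda>_. ?p) < expectation Z"
      by (intro integral_less_AE_space int) (auto simp: emeasure_space_1)
    then show False by (simp add: prob_space)
  qed
  ultimately have "AE v in P. v \<notin> A"
    using A by (simp add: prob_eq_0)
  then have le: "AE v in P. 0 \<le> ?p - Z v" using AE_space by eventually_elim (auto simp: A_def)
  have "expectation (\<lambda>v. ?p - Z v) = 0"
    using int by (simp add: prob_space)
  then have "AE v in P. ?p - Z v = 0"
    using integral_nonneg_eq_0_iff_AE[OF _ le] int by simp
  then show ?thesis by eventually_elim simp
qed


text \<open>Averages over growing sets have a subsequence with an almost sure limit
  \<open>Z\<close>, which is invariant and so equal to \<open>p\<close>. Along it the second moments
  tend to \<open>p\<^sup>2\<close>, while their explicit value \<open>q + (p - q) / (n + 1)\<close>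
  tends to \<open>q\<close>.\<close>

lemma ergodic_pair_infinite:
  assumes erg: "ergodic_measure W G P" and inf: "infinite X" and B: "B \<in> sets (label_space L)"
    and xy: "x \<in> X" "y \<in> X" "x \<noteq> y"
  shows "expectation (\<lambda>v. hit B x v * hit B y v) = (expectation (hit B x))\<^sup>2"
proof -
  define p q where "p = expectation (hit B x)" and "q = expectation (\<lambda>v. hit B x v * hit B y v)"
  obtain e :: "nat \<Rightarrow> 'w" where e: "inj e" "range e \<subseteq> X"
    using infinite_countable_subset[OF inf] by blast
  \<comment> \<open>The index set \<open>{..n}\<close> has \<open>n + 1\<close> elements, so every
    \<open>S n\<close> is nonempty and no average divides by zero.\<close>
  define S where "S n = e ` {..n}" for n
  have S: "finite (S n)" "S n \<noteq> {}" "S n \<subseteq> X" "card (S n) = Suc n" for n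
    using e card_image[OF inj_on_subset[OF e(1)], of "{..n}"] by (auto simp: S_def)
  have mA: "avg B (S n) \<in> borel_measurable P" for n
    using S(3)[of n] X_sub by (intro avg_measurable B) auto
  have lim0: "(\<lambda>n. sqrt (2 / Suc n + 2 / Suc n)) \<longlonglongrightarrow> 0"
    by real_asymp
  have cauchy: "\<exists>N. \<forall>i\<ge>N. \<forall>j\<ge>N. LINT v|P. norm (avg B (S i) v - avg B (S j) v) < \<epsilon>" if \<epsilon>: "\<epsilon> > 0" for \<epsilon>
  proof -
    obtain N where N: "sqrt (2 / Suc N + 2 / Suc N) < \<epsilon>"
      using order_tendstoD(2)[OF lim0 \<epsilon>] by (auto simp: eventually_sequentially)
    have "LINT v|P. norm (avg B (S i) v - avg B (S j) v) < \<epsilon>" if "i \<ge> N" "j \<ge> N" for i j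
    proof -
      have "(LINT v|P. norm (avg B (S i) v - avg B (S j) v)) \<le> sqrt (2 / card (S i) + 2 / card (S j))"
        using avg_diff_L1[OF S(1-3) S(1-3) B inf] by simp
      also have "\<dots> \<le> sqrt (2 / Suc N + 2 / Suc N)"
        unfolding S(4) using that by (intro real_sqrt_le_mono add_mono divide_left_mono) auto
      finally show ?thesis using N by simp
    qed
    then show ?thesis by blast
  qed
  obtain r where r: "strict_mono r" "AE v in P. Cauchy (\<lambda>k. avg B (S (r k)) v)"
    by (rule cauchy_L1_AE_cauchy_subseq[OF _ cauchy])
      (auto intro!: integrable_bounded[where c=1] mA simp: avg_01 abs_le_iff intro: order_trans[OF _ avg_01(1)])
  \<comment> \<open>Clamping to \<open>[0, 1]\<close> bounds \<open>Z\<close> everywhere, even where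
    the sequence fails to converge. On the convergence event it changes nothing, as the averages
    already lie there.\<close>
  define Z where "Z v = max 0 (min 1 (lim (\<lambda>k. avg B (S (r k)) v)))" for v
  have mZ: "Z \<in> borel_measurable P"
    unfolding Z_def using mA by (intro borel_measurable_max borel_measurable_min borel_measurable_lim_metric) auto
  have Z01: "\<bar>Z v\<bar> \<le> 1" for v by (auto simp: Z_def)
  have conv: "AE v in P. (\<lambda>k. avg B (S (r k)) v) \<longlonglongrightarrow> Z v"
    using r(2)
  proof eventually_elim
    fix v assume "Cauchy (\<lambda>k. avg B (S (r k)) v)"
    then have l: "(\<lambda>k. avg B (S (r k)) v) \<longlonglongrightarrow> lim (\<lambda>k. avg B (S (r k)) v)"
      using Cauchy_convergent_iff convergent_LIMSEQ_iff by blast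
    have "0 \<le> lim (\<lambda>k. avg B (S (r k)) v)" "lim (\<lambda>k. avg B (S (r k)) v) \<le> 1"
      using LIMSEQ_le_const[OF l] LIMSEQ_le_const2[OF l] avg_01 by blast+
    with l show "(\<lambda>k. avg B (S (r k)) v) \<longlonglongrightarrow> Z v" by (simp add: Z_def)
  qed
  \<comment> \<open>The L1 distance between the averages before and after \<open>\<pi>\<close> tends
    to 0 by \<open>avg_diff_L1\<close>, and to the L1 distance between the two values of
    \<open>Z\<close> by dominated convergence; so the latter vanishes.\<close>
  have inv: "AE v in P. Z (act W \<pi> v) = Z v" if \<pi>: "\<pi> \<in> G" for \<pi>
  proof -
    let ?D = "\<lambda>k v. avg B (S (r k)) (act W \<pi> v) - avg B (S (r k)) v"
    have mact: "(\<lambda>v. f (act W \<pi> v)) \<in> borel_measurable P" if "f \<in> borel_measurable P" for f :: "_ \<Rightarrow> real"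
      using measurable_compose[OF act_measurable[OF \<pi>] that] .
    have "expectation (\<lambda>v. \<bar>?D k v\<bar>) \<le> sqrt (2 / Suc (r k) + 2 / Suc (r k))" for k
      using avg_diff_L1[of "inv_into W \<pi> ` S (r k)" "S (r k)" B] avg_act[OF \<pi>, of "S (r k)"] S B inf
      by simp
    then have "expectation (\<lambda>v. \<bar>?D k v\<bar>) \<le> (\<lambda>n. sqrt (2 / Suc n + 2 / Suc n)) (r k)" for k
      by simp
    then have "(\<lambda>k. expectation (\<lambda>v. \<bar>?D k v\<bar>)) \<longlonglongrightarrow> 0"
      by (intro tendsto_sandwich[OF _ _ tendsto_const
            LIMSEQ_subseq_LIMSEQ[OF lim0 r(1), unfolded comp_def]]) auto
    moreover have "(\<lambda>k. expectation (\<lambda>v. \<bar>?D k v\<bar>)) \<longlonglongrightarrow> expectation (\<lambda>v. \<bar>Z (act W \<pi> v) - Z v\<bar>)"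
    proof (rule integral_dominated_convergence[where w="\<lambda>_. 1"])
      \<comment> \<open>Convergence at \<open>act W \<pi> v\<close> is also almost sure, because the
        action preserves \<open>P\<close>.\<close>
      show "AE v in P. (\<lambda>k. \<bar>?D k v\<bar>) \<longlonglongrightarrow> \<bar>Z (act W \<pi> v) - Z v\<bar>"
        using conv AE_act[OF \<pi> conv] by eventually_elim (intro tendsto_intros)
      show "AE v in P. norm \<bar>?D k v\<bar> \<le> 1" for k
        using avg_01[of B "S (r k)"] by (auto simp: abs_le_iff intro!: AE_I2 add_mono)
          (metis add.commute add_increasing2 diff_le_eq order_trans)+
    qed (auto intro!: borel_measurable_abs borel_measurable_diff mact mA mZ)
    ultimately have "expectation (\<lambda>v. \<bar>Z (act W \<pi> v) - Z v\<bar>) = 0"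
      using LIMSEQ_unique by blast
    moreover have "integrable P (\<lambda>v. \<bar>Z (act W \<pi> v) - Z v\<bar>)"
    proof (rule integrable_bounded[where c=2])
      fix v show "\<bar>\<bar>Z (act W \<pi> v) - Z v\<bar>\<bar> \<le> 2" using Z01[of v] Z01[of "act W \<pi> v"] by auto
    qed (auto intro!: borel_measurable_abs borel_measurable_diff mact mZ)
    ultimately have "AE v in P. \<bar>Z (act W \<pi> v) - Z v\<bar> = 0"
      by (subst integral_nonneg_eq_0_iff_AE[symmetric]) auto
    then show ?thesis by eventually_elim simp
  qed
  have const: "AE v in P. Z v = expectation Z"
    by (rule ergodic_invariant_const[OF erg mZ Z01 inv])
  have "(\<lambda>k. expectation (avg B (S (r k)))) \<longlonglongrightarrow> expectation Z"
    using conv by (intro integral_dominated_convergence[where w="\<lambda>_. 1"]) (auto simp: mA mZ avg_01)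
  then have EZ: "expectation Z = p"
    using expectation_avg[OF S(1-3) B xy(1)] by (simp add: p_def LIMSEQ_const_iff)
  have "(\<lambda>k. expectation (\<lambda>v. (avg B (S (r k)) v)\<^sup>2)) \<longlonglongrightarrow> expectation (\<lambda>v. (Z v)\<^sup>2)"
  proof (rule integral_dominated_convergence[where w="\<lambda>_. 1"])
    show "AE v in P. (\<lambda>k. (avg B (S (r k)) v)\<^sup>2) \<longlonglongrightarrow> (Z v)\<^sup>2"
      using conv by eventually_elim (intro tendsto_intros)
  qed (auto intro!: borel_measurable_power mA mZ AE_I2 power_le_one avg_01)
  moreover have "expectation (\<lambda>v. (Z v)\<^sup>2) = expectation (\<lambda>v. p\<^sup>2)"
    using const unfolding EZ by (intro integral_cong_AE) (auto intro!: borel_measurable_power mZ)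
  \<comment> \<open>Among the \<open>(n + 1)\<^sup>2\<close> pairs of worlds in \<open>S n\<close>,
    the \<open>n + 1\<close> diagonal ones contribute \<open>p\<close> and the others
    \<open>q\<close>.\<close>
  moreover have "expectation (\<lambda>v. (avg B (S n) v)\<^sup>2) = q + (p - q) / Suc n" for n
  proof -
    have "(\<Sum>a\<in>S n. \<Sum>b\<in>S n. expectation (\<lambda>v. hit B a v * hit B b v)) =
        (\<Sum>a\<in>S n. \<Sum>b\<in>S n. 1 * 1 * (if a = b then p else q))"
      unfolding p_def q_def
      by (intro sum.cong refl)
        (use S(3)[of n] expectation_hit2[OF xy _ _ B] in \<open>simp add: subset_iff\<close>)
    also have "\<dots> = q * (Suc n)\<^sup>2 + (p - q) * Suc n"
      by (subst sum_pairs[OF S(1)]) (simp add: S(4))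
    finally have eq: "(\<Sum>a\<in>S n. \<Sum>b\<in>S n. expectation (\<lambda>v. hit B a v * hit B b v)) =
        q * (real (Suc n))\<^sup>2 + (p - q) * real (Suc n)" by simp
    have "(q * N\<^sup>2 + (p - q) * N) / N\<^sup>2 = q + (p - q) / N" if "N > 0" for N :: real
      using that by (simp add: add_divide_distrib power2_eq_square)
    from this[of "real (Suc n)"] show ?thesis
      unfolding expectation_avg_sq[OF S(1,3) B] eq S(4) by simp
  qed
  ultimately have "(\<lambda>k. q + (p - q) / Suc (r k)) \<longlonglongrightarrow> p\<^sup>2" by (simp add: prob_space)
  moreover have "(\<lambda>k. q + (p - q) / Suc (r k)) \<longlonglongrightarrow> q"
  proof -
    have "(\<lambda>n. q + (p - q) / Suc n) \<longlonglongrightarrow> q" by real_asymp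
    from LIMSEQ_subseq_LIMSEQ[OF this r(1)] show ?thesis by (simp add: comp_def)
  qed
  ultimately show ?thesis unfolding p_def[symmetric] q_def[symmetric] by (rule LIMSEQ_unique[symmetric])
qed

text \<open>A finite orbit is averaged as a whole: \<open>G\<close> permutes it, so the average is
  invariant and almost surely constant, with no error. In an infinite orbit the pair moments are
  \<open>p\<^sup>2\<close>, and the diagonal leaves an error of at most \<open>1 / card S\<close>.
  The hypothesis \<open>fin\<close> puts both cases under one bound.\<close>

lemma ergodic_avg_sq:
  assumes erg: "ergodic_measure W G P" and B: "B \<in> sets (label_space L)"
    and S: "finite S" "S \<noteq> {}" "S \<subseteq> X" and x: "x \<in> X" and fin: "finite X \<Longrightarrow> S = X"
  shows "expectation (\<lambda>v. (avg B S v)\<^sup>2) \<le>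
    (expectation (hit B x))\<^sup>2 + (if finite X then 0 else 1 / card S)"
proof (cases "finite X")
  case True
  have inv: "AE v in P. avg B S (act W \<pi> v) = avg B S v" if \<pi>: "\<pi> \<in> G" for \<pi>
  proof -
    have "inv_into W \<pi> ` S = S"
      using avg_act(1,2)[OF \<pi>, of S] fin[OF True] True by (metis card_subset_eq order_refl)
    then show ?thesis using avg_act(3)[OF \<pi> S(3)] by simp
  qed
  have mA: "avg B S \<in> borel_measurable P"
    using S X_sub by (intro avg_measurable B) auto
  have "AE v in P. avg B S v = expectation (avg B S)"
    by (rule ergodic_invariant_const[where c=1, OF erg mA _ inv])
      (use avg_01[of B S] in \<open>auto simp: abs_le_iff intro: order_trans[of _ 0]\<close>)
  then have "expectation (\<lambda>v. (avg B S v)\<^sup>2) = expectation (\<lambda>v. (expectation (hit B x))\<^sup>2)"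
    unfolding expectation_avg[OF S B x]
    by (intro integral_cong_AE) (auto intro!: borel_measurable_power mA)
  then show ?thesis using True by (simp add: prob_space)
next
  case False
  obtain y where y: "y \<in> X" "x \<noteq> y"
    using infinite_remove[OF False, of x] by (metis Diff_iff ex_in_conv finite.emptyI singletonI)
  define p where "p = expectation (hit B x)"
  have "(\<Sum>a\<in>S. \<Sum>b\<in>S. expectation (\<lambda>v. hit B a v * hit B b v)) =
      (\<Sum>a\<in>S. \<Sum>b\<in>S. 1 * 1 * (if a = b then p else p\<^sup>2))"
    unfolding p_def ergodic_pair_infinite[OF erg False B x y, symmetric]
    by (intro sum.cong refl) (use S(3) expectation_hit2[OF x y _ _ B] in \<open>simp add: subset_iff\<close>)
  also have "\<dots> = p\<^sup>2 * (card S)\<^sup>2 + (p - p\<^sup>2) * card S"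
    by (subst sum_pairs[OF S(1)]) simp
  finally have "expectation (\<lambda>v. (avg B S v)\<^sup>2) = p\<^sup>2 + (p - p\<^sup>2) / card S"
    using S by (subst expectation_avg_sq[OF S(1,3) B])
      (simp add: add_divide_distrib power2_eq_square)
  also have "(p - p\<^sup>2) / card S \<le> 1 / card S"
  proof (rule divide_right_mono)
    have "p \<le> 1" unfolding p_def using B x X_sub
      by (intro integral_le_const integrable_bounded[where c=1] hit_measurable)
        (auto simp: hit_def indicator_def)
    then show "p - p\<^sup>2 \<le> 1" using zero_le_power2[of p] by linarith
  qed simp
  finally show ?thesis using False by (simp add: p_def)
qed

end

section \<open>The directing law of an orbit\<close>

lemma subalgebra_generated_field:
  assumes "f \<in> measurable P N"
  shows "subalgebra P (generated_field P f N)"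
  using measurable_space[OF assms] measurable_sets[OF assms]
  by (auto simp: subalgebra_def generated_field_def sets_vimage_algebra2)

lemma sets_generated_field:
  assumes "f \<in> space P \<rightarrow> space N"
  shows "sets (generated_field P f N) = {f -` A \<inter> space P | A. A \<in> sets N}"
  using assms by (simp add: generated_field_def sets_vimage_algebra2)

lemma measurable_generated_field:
  assumes "f \<in> space P \<rightarrow> space N"
  shows "f \<in> measurable (generated_field P f N) N"
  using assms unfolding generated_field_def by (rule measurable_vimage_algebra1)

text \<open>The base world \<open>x0\<close> serves to read off a marginal of each
  \<open>\<kappa> \<xi>\<close>; \<open>H\<close> may be any version of the invariant field.\<close>

locale decomposed_orbit_law = orbit_law P W L G X
  for P :: "('w \<Rightarrow> 'l \<Rightarrow> bool) measure" and W L G X +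
  fixes H :: "('w \<Rightarrow> 'l \<Rightarrow> bool) measure" and E :: "'x measure"
    and \<Xi> :: "('w \<Rightarrow> 'l \<Rightarrow> bool) \<Rightarrow> 'x" and \<kappa> :: "'x \<Rightarrow> ('w \<Rightarrow> 'l \<Rightarrow> bool) measure" and x0 :: 'w
  assumes version: "inv_field_version W L G P H"
    and decomp: "ergodic_decomposition W L G P H E \<Xi> \<kappa>"
    and x0: "x0 \<in> X"
begin

section \<open>The ergodic kernel and its integrals\<close>

lemma subalgebra_H: "subalgebra P H"
  using version by (simp add: inv_field_version_def)

lemma \<Xi>_H: "\<Xi> \<in> measurable H E"
  using decomp by (simp add: ergodic_decomposition_def)

lemma \<Xi>_P: "\<Xi> \<in> measurable P E"
  by (rule measurable_from_subalg[OF subalgebra_H \<Xi>_H])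

lemma \<kappa>_measurable: "\<kappa> \<in> measurable E (prob_algebra (val_space W L))"
  using decomp by (simp add: ergodic_decomposition_def)

lemma \<kappa>_space:
  assumes "\<xi> \<in> space E"
  shows "sets (\<kappa> \<xi>) = sets (val_space W L)" "prob_space (\<kappa> \<xi>)" "space (\<kappa> \<xi>) = space (val_space W L)"
proof -
  show *: "sets (\<kappa> \<xi>) = sets (val_space W L)" "prob_space (\<kappa> \<xi>)"
    using measurable_space[OF \<kappa>_measurable assms] by (auto simp: space_prob_algebra)
  show "space (\<kappa> \<xi>) = space (val_space W L)"
    by (rule sets_eq_imp_space_eq[OF *(1)])
qed

lemma measurable_measure_\<kappa>:
  assumes "A \<in> sets (val_space W L)"
  shows "(\<lambda>\<xi>. measure (\<kappa> \<xi>) A) \<in> borel_measurable E"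
  by (rule measurable_compose[OF \<kappa>_measurable measurable_measure_prob_algebra[OF assms]])

lemma measure_\<kappa>_01: "\<xi> \<in> space E \<Longrightarrow> \<bar>measure (\<kappa> \<xi>) A\<bar> \<le> 1"
  using prob_space.prob_le_1[OF \<kappa>_space(2), of \<xi> A] by simp

lemma AE_ergodic: "AE v in P. ergodic_measure W G (\<kappa> (\<Xi> v))"
  using decomp by (auto simp: ergodic_decomposition_def intro: AE_distrD[OF \<Xi>_P])

lemma orbit_law_\<kappa>:
  assumes "\<xi> \<in> space E" "ergodic_measure W G (\<kappa> \<xi>)"
  shows "orbit_law (\<kappa> \<xi>) W L G X"
  using assms \<kappa>_space[OF assms(1)] bij X_sub X_image ext
  by (auto simp: orbit_law_def orbit_law_axioms_def ergodic_measure_def)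

text \<open>The defining identity of the decomposition says that
  \<open>measure (\<kappa> (\<Xi> v)) A\<close> is a version of the conditional probability of
  \<open>A\<close> given the field generated by \<open>\<Xi>\<close>. The factor
  \<open>g (\<Xi> v)\<close> is measurable there and can be pulled out.\<close>

lemma integral_kernel:
  assumes A: "A \<in> sets (val_space W L)" and g: "g \<in> borel_measurable E"
    and bound: "\<And>\<xi>. \<xi> \<in> space E \<Longrightarrow> \<bar>g \<xi>\<bar> \<le> (c::real)"
  shows "(\<integral>v. g (\<Xi> v) * indicator A v \<partial>P) = (\<integral>v. g (\<Xi> v) * measure (\<kappa> (\<Xi> v)) A \<partial>P)"
proof -
  let ?F = "generated_field P \<Xi> E" and ?k = "\<lambda>v. measure (\<kappa> (\<Xi> v)) A"
  have \<Xi>: "\<Xi> \<in> space P \<rightarrow> space E" using measurable_space[OF \<Xi>_P] by auto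
  interpret F: finite_measure_subalgebra P ?F
    by standard (rule subalgebra_generated_field[OF \<Xi>_P])
  have AP: "A \<in> sets P" using A sets_P by simp
  have kF: "?k \<in> borel_measurable ?F"
    by (rule measurable_compose[OF measurable_generated_field[OF \<Xi>] measurable_measure_\<kappa>[OF A]])
  have kP: "?k \<in> borel_measurable P"
    by (rule measurable_from_subalg[OF F.subalg kF])
  have gF: "(\<lambda>v. g (\<Xi> v)) \<in> borel_measurable ?F"
    by (rule measurable_compose[OF measurable_generated_field[OF \<Xi>] g])
  have gP: "(\<lambda>v. g (\<Xi> v)) \<in> borel_measurable P"
    by (rule measurable_from_subalg[OF F.subalg gF])
  have "AE v in P. real_cond_exp P ?F (indicator A) v = ?k v"
  proof (rule F.real_cond_exp_charact[OF _ _ _ kF])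
    show "integrable P (indicator A :: _ \<Rightarrow> real)"
      using AP by (intro integrable_const_bound[where B=1]) auto
    show "integrable P ?k"
      by (rule integrable_const_bound[where B=1, OF AE_I2 kP])
        (use \<Xi> measure_\<kappa>_01 in auto)
    fix C assume "C \<in> sets ?F"
    then obtain B where B: "B \<in> sets E" "C = \<Xi> -` B \<inter> space P"
      by (auto simp: sets_generated_field[OF \<Xi>])
    have C: "C \<in> sets P" using B measurable_sets[OF \<Xi>_P] by simp
    have "emeasure P (A \<inter> C) = (\<integral>\<^sup>+ \<xi>\<in>B. emeasure (\<kappa> \<xi>) A \<partial>distr P E \<Xi>)"
      using decomp B AP by (simp add: ergodic_decomposition_def)
    also have "\<dots> = (\<integral>\<^sup>+ v. emeasure (\<kappa> (\<Xi> v)) A * indicator B (\<Xi> v) \<partial>P)"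
      using B(1) measurable_compose[OF measurable_prob_algebraD[OF \<kappa>_measurable]
          measurable_emeasure_subprob_algebra[OF A]]
      by (subst nn_integral_distr[OF \<Xi>_P]) auto
    also have "\<dots> = (\<integral>\<^sup>+ v. ennreal (indicator C v * ?k v) \<partial>P)"
    proof (rule nn_integral_cong)
      fix v assume v: "v \<in> space P"
      then interpret k: prob_space "\<kappa> (\<Xi> v)" using \<kappa>_space(2) \<Xi> by auto
      show "emeasure (\<kappa> (\<Xi> v)) A * indicator B (\<Xi> v) = ennreal (indicator C v * ?k v)"
        using v B by (auto simp: k.emeasure_eq_measure indicator_def)
    qed
    finally have "(\<integral>v. indicator C v * ?k v \<partial>P) = prob (A \<inter> C)"
      using kP C by (subst integral_eq_nn_integral) (auto simp: measure_def)
    moreover have "(\<integral>v. indicator C v * indicator A v \<partial>P) = prob (A \<inter> C)"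
      using AP C by (simp add: indicator_inter_arith[symmetric] Int_commute)
    ultimately show "(LINT v:C|P. indicator A v) = (LINT v:C|P. ?k v)"
      by (simp add: set_lebesgue_integral_def)
  qed
  then have "(\<integral>v. g (\<Xi> v) * ?k v \<partial>P) = (\<integral>v. g (\<Xi> v) * real_cond_exp P ?F (indicator A) v \<partial>P)"
    using gP kP by (intro integral_cong_AE) (auto simp: borel_measurable_cond_exp2)
  also have "\<dots> = (\<integral>v. g (\<Xi> v) * indicator A v \<partial>P)"
  proof (rule F.real_cond_exp_intg(2)[OF _ gF])
    \<comment> \<open>Off \<open>A\<close> the integrand is 0, so bounding it by \<open>c\<close>
      requires \<open>0 \<le> c\<close>.\<close>
    have "0 \<le> c" if "v \<in> space P" for v using bound[of "\<Xi> v"] \<Xi> that by force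
    then show "integrable P (\<lambda>v. g (\<Xi> v) * indicator A v)"
      using gP AP \<Xi> bound
      by (intro integrable_const_bound[where B=c] AE_I2) (auto simp: indicator_def)
  qed (use AP in auto)
  finally show ?thesis by simp
qed

text \<open>The integrals over \<open>P\<close> and over the kernel laws are reduced to one event
  \<open>A\<close>, to which \<open>integral_kernel\<close> applies; this also gives measurability
  in \<open>\<xi>\<close>.\<close>

lemma hit2_eventE:
  assumes x: "x \<in> W" "y \<in> W" and B: "B \<in> sets (label_space L)"
  obtains A where "A \<in> sets (val_space W L)"
    "\<And>v. v \<in> space (val_space W L) \<Longrightarrow> hit B x v * hit B y v = indicator A v"
    "\<And>\<xi>. \<xi> \<in> space E \<Longrightarrow> (\<integral>u. hit B x u * hit B y u \<partial>\<kappa> \<xi>) = measure (\<kappa> \<xi>) A"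
proof -
  define A where "A = {v \<in> space (val_space W L). v x \<in> B \<and> v y \<in> B}"
  have m: "(\<lambda>v. v z) \<in> measurable (val_space W L) (label_space L)" if "z \<in> W" for z
    unfolding val_space_def by (rule measurable_component_singleton[OF that])
  have "A = ((\<lambda>v. v x) -` B \<inter> space (val_space W L)) \<inter> ((\<lambda>v. v y) -` B \<inter> space (val_space W L))"
    by (auto simp: A_def)
  then have A: "A \<in> sets (val_space W L)"
    using measurable_sets[OF m[OF x(1)] B] measurable_sets[OF m[OF x(2)] B] by simp
  have hA: "hit B x v * hit B y v = indicator A v" if "v \<in> space (val_space W L)" for v
    using that by (auto simp: hit_def A_def indicator_def)
  have "(\<integral>u. hit B x u * hit B y u \<partial>\<kappa> \<xi>) = measure (\<kappa> \<xi>) A" if "\<xi> \<in> space E" for \<xi>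
  proof -
    interpret k: prob_space "\<kappa> \<xi>" by (rule \<kappa>_space(2)[OF that])
    have "(\<integral>u. hit B x u * hit B y u \<partial>\<kappa> \<xi>) = (\<integral>u. indicator A u \<partial>\<kappa> \<xi>)"
      using hA \<kappa>_space(3)[OF that] by (intro Bochner_Integration.integral_cong) auto
    also have "\<dots> = measure (\<kappa> \<xi>) A"
      using A \<kappa>_space(1)[OF that] by simp
    finally show ?thesis .
  qed
  with A hA show ?thesis by (rule that)
qed

lemma measurable_kernel_hit2:
  assumes "x \<in> W" "y \<in> W" "B \<in> sets (label_space L)"
  shows "(\<lambda>\<xi>. \<integral>u. hit B x u * hit B y u \<partial>\<kappa> \<xi>) \<in> borel_measurable E"
proof -
  obtain A where A: "A \<in> sets (val_space W L)"
    "\<And>\<xi>. \<xi> \<in> space E \<Longrightarrow> (\<integral>u. hit B x u * hit B y u \<partial>\<kappa> \<xi>) = measure (\<kappa> \<xi>) A"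
    by (rule hit2_eventE[OF assms], rule that)
  show ?thesis using measurable_measure_\<kappa>[OF A(1)] by (subst measurable_cong[OF A(2)])
qed

lemma kernel_hit2_01:
  assumes "x \<in> W" "y \<in> W" "B \<in> sets (label_space L)" "\<xi> \<in> space E"
  shows "\<bar>\<integral>u. hit B x u * hit B y u \<partial>\<kappa> \<xi>\<bar> \<le> 1"
  by (rule hit2_eventE[OF assms(1-3)]) (use measure_\<kappa>_01[OF assms(4)] assms(4) in simp)

lemma integral_kernel_hit2:
  assumes x: "x \<in> W" "y \<in> W" and B: "B \<in> sets (label_space L)" and g: "g \<in> borel_measurable E"
    and bound: "\<And>\<xi>. \<xi> \<in> space E \<Longrightarrow> \<bar>g \<xi>\<bar> \<le> (c::real)"
  shows "(\<integral>v. g (\<Xi> v) * (hit B x v * hit B y v) \<partial>P) =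
    (\<integral>v. g (\<Xi> v) * (\<integral>u. hit B x u * hit B y u \<partial>\<kappa> (\<Xi> v)) \<partial>P)"
proof -
  obtain A where A: "A \<in> sets (val_space W L)"
    "\<And>v. v \<in> space (val_space W L) \<Longrightarrow> hit B x v * hit B y v = indicator A v"
    "\<And>\<xi>. \<xi> \<in> space E \<Longrightarrow> (\<integral>u. hit B x u * hit B y u \<partial>\<kappa> \<xi>) = measure (\<kappa> \<xi>) A"
    by (rule hit2_eventE[OF x B], rule that)
  have "(\<integral>v. g (\<Xi> v) * (hit B x v * hit B y v) \<partial>P) = (\<integral>v. g (\<Xi> v) * indicator A v \<partial>P)"
    using A(2) space_P by (intro Bochner_Integration.integral_cong) auto
  also have "\<dots> = (\<integral>v. g (\<Xi> v) * measure (\<kappa> (\<Xi> v)) A \<partial>P)"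
    by (rule integral_kernel[OF A(1) g bound])
  also have "\<dots> = (\<integral>v. g (\<Xi> v) * (\<integral>u. hit B x u * hit B y u \<partial>\<kappa> (\<Xi> v)) \<partial>P)"
    using A(3) measurable_space[OF \<Xi>_P] by (intro Bochner_Integration.integral_cong) auto
  finally show ?thesis .
qed

lemma hit_idem: "hit B x v * hit B x v = hit B x v"
  by (simp add: hit_def indicator_def)

text \<open>Equal worlds turn the pair statements into statements on a single indicator, by
  idempotence.\<close>

lemmas integral_kernel_hit = integral_kernel_hit2[where y=x and x=x for x, unfolded hit_idem]
lemmas measurable_kernel_hit = measurable_kernel_hit2[where y=x and x=x for x, unfolded hit_idem]

section \<open>The directing law as a limit of averages\<close>

text \<open>A marginal of the kernel is measurable in \<open>\<xi>\<close> without any passage to a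
  limit. The choice of \<open>x0\<close> matters at most on a null set of \<open>\<xi>\<close>,
  because under an ergodic \<open>\<kappa> \<xi>\<close> all worlds of \<open>X\<close> have the
  same marginal.\<close>

definition dir :: "'x \<Rightarrow> ('l \<Rightarrow> bool) measure" where
  "dir \<xi> = distr (\<kappa> \<xi>) (label_space L) (\<lambda>v. v x0)"

lemma measurable_dir: "dir \<in> measurable E (prob_algebra (label_space L))"
proof -
  have "(\<lambda>v. v x0) \<in> measurable (val_space W L) (label_space L)"
    unfolding val_space_def using x0 X_sub by (intro measurable_component_singleton) auto
  then show ?thesis
    unfolding dir_def by (intro measurable_compose[OF \<kappa>_measurable] measurable_distr_prob_space)
qed

lemma measure_dir:
  assumes "\<xi> \<in> space E" "B \<in> sets (label_space L)"
  shows "measure (dir \<xi>) B = (\<integral>u. hit B x0 u \<partial>\<kappa> \<xi>)"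
proof -
  interpret k: prob_space "\<kappa> \<xi>" by (rule \<kappa>_space(2)[OF assms(1)])
  have m: "(\<lambda>v. v x0) \<in> measurable (\<kappa> \<xi>) (label_space L)"
    using x0 X_sub measurable_cong_sets[OF \<kappa>_space(1)[OF assms(1)] refl]
    unfolding val_space_def by (auto intro: measurable_component_singleton)
  have "measure (dir \<xi>) B = (\<integral>u. indicator B u \<partial>dir \<xi>)"
    using assms by (simp add: dir_def)
  also have "\<dots> = (\<integral>u. hit B x0 u \<partial>\<kappa> \<xi>)"
    unfolding dir_def hit_def by (rule integral_distr[OF m]) (use assms in auto)
  finally show ?thesis .
qed

lemma measurable_measure_dir:
  assumes "B \<in> sets (label_space L)"
  shows "(\<lambda>\<xi>. measure (dir \<xi>) B) \<in> borel_measurable E"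
  by (rule measurable_compose[OF measurable_dir measurable_measure_prob_algebra[OF assms]])

lemma measure_dir_01: "\<xi> \<in> space E \<Longrightarrow> \<bar>measure (dir \<xi>) B\<bar> \<le> 1"
  using measurable_space[OF measurable_dir, of \<xi>] prob_space.prob_le_1[of "dir \<xi>" B]
  by (simp add: space_prob_algebra)

text \<open>Let \<open>l\<close> be the directing probability of \<open>B\<close> and expand the
  square of the average minus \<open>l\<close>. The product of \<open>l\<close> and the average has
  the same mean as \<open>l\<^sup>2\<close>, since each world has conditional probability
  \<open>l\<close>. The second moment of the average exceeds that mean by at most
  \<open>\<delta>\<close>, so after cancellation only \<open>\<delta>\<close> remains.\<close>

lemma avg_dir_L1:
  assumes B: "B \<in> sets (label_space L)"
    and S: "finite S" "S \<noteq> {}" "S \<subseteq> X" and fin: "finite X \<Longrightarrow> S = X"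
  shows "expectation (\<lambda>v. \<bar>avg B S v - measure (dir (\<Xi> v)) B\<bar>)
    \<le> sqrt (if finite X then 0 else 1 / card S)"
proof -
  define l where "l \<xi> = measure (dir \<xi>) B" for \<xi>
  define \<delta> where "\<delta> = (if finite X then 0 else 1 / real (card S))"
  have SW: "S \<subseteq> W" using S X_sub by auto
  have \<Xi>: "v \<in> space P \<Longrightarrow> \<Xi> v \<in> space E" for v using measurable_space[OF \<Xi>_P] .
  have lE: "l \<in> borel_measurable E" unfolding l_def by (rule measurable_measure_dir[OF B])
  have l1: "\<bar>l \<xi>\<bar> \<le> 1" if "\<xi> \<in> space E" for \<xi> unfolding l_def by (rule measure_dir_01[OF that])
  have lP: "(\<lambda>v. l (\<Xi> v)) \<in> borel_measurable P" by (rule measurable_compose[OF \<Xi>_P lE])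
  have aP: "avg B S \<in> borel_measurable P" by (rule avg_measurable[OF SW B])
  have sq1: "\<bar>(t::real)\<^sup>2\<bar> \<le> 1" if "\<bar>t\<bar> \<le> 1" for t
    using that by (simp add: abs_square_le_1)
  have al: "\<bar>avg B S v\<bar> \<le> 1" for v using avg_01[of B S v] by simp
  have int1: "integrable P f" if "f \<in> borel_measurable P" "\<And>v. v \<in> space P \<Longrightarrow> \<bar>f v\<bar> \<le> c" for f :: "_ \<Rightarrow> real" and c
    using that by (intro integrable_const_bound[where B=c] AE_I2) auto
  have il: "integrable P (\<lambda>v. (l (\<Xi> v))\<^sup>2)"
    by (intro int1[of _ 1] borel_measurable_power lP sq1 l1 \<Xi>)
  \<comment> \<open>Under almost every kernel law the worlds \<open>x\<close> and \<open>x0\<close>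
    have the same marginal, so conditioning on \<open>\<Xi>\<close> replaces the indicator by
    \<open>l\<close>.\<close>
  have hl: "(\<integral>v. l (\<Xi> v) * hit B x v \<partial>P) = (\<integral>v. (l (\<Xi> v))\<^sup>2 \<partial>P)" if x: "x \<in> S" for x
  proof -
    have xX: "x \<in> X" "x \<in> W" using x S X_sub by auto
    have "(\<integral>v. l (\<Xi> v) * hit B x v \<partial>P) = (\<integral>v. l (\<Xi> v) * (\<integral>u. hit B x u \<partial>\<kappa> (\<Xi> v)) \<partial>P)"
      by (rule integral_kernel_hit[OF xX(2) xX(2) B lE l1])
    also have "\<dots> = (\<integral>v. (l (\<Xi> v))\<^sup>2 \<partial>P)"
    proof (rule integral_cong_AE)
      show "AE v in P. l (\<Xi> v) * (\<integral>u. hit B x u \<partial>\<kappa> (\<Xi> v)) = (l (\<Xi> v))\<^sup>2"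
        using AE_ergodic AE_space
      proof eventually_elim
        fix v assume v: "ergodic_measure W G (\<kappa> (\<Xi> v))" "v \<in> space P"
        interpret k: orbit_law "\<kappa> (\<Xi> v)" W L G X by (rule orbit_law_\<kappa>[OF \<Xi>[OF v(2)] v(1)])
        show "l (\<Xi> v) * (\<integral>u. hit B x u \<partial>\<kappa> (\<Xi> v)) = (l (\<Xi> v))\<^sup>2"
          unfolding l_def measure_dir[OF \<Xi>[OF v(2)] B] k.expectation_hit_eq[OF xX(1) x0 B]
          by (simp add: power2_eq_square)
      qed
    next
      have "(\<lambda>v. \<integral>u. hit B x u \<partial>\<kappa> (\<Xi> v)) \<in> borel_measurable P"
        by (rule measurable_compose[OF \<Xi>_P measurable_kernel_hit[OF xX(2) xX(2) B]])
      then show "(\<lambda>v. l (\<Xi> v) * (\<integral>u. hit B x u \<partial>\<kappa> (\<Xi> v))) \<in> borel_measurable P"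
        by (intro borel_measurable_times lP)
    qed (intro borel_measurable_power lP)
    finally show ?thesis .
  qed
  have El: "(\<integral>v. l (\<Xi> v) * avg B S v \<partial>P) = (\<integral>v. (l (\<Xi> v))\<^sup>2 \<partial>P)"
  proof -
    have "(\<integral>v. l (\<Xi> v) * avg B S v \<partial>P) = (\<integral>v. (\<Sum>x\<in>S. l (\<Xi> v) * hit B x v) / card S \<partial>P)"
      by (simp add: avg_def sum_distrib_left)
    also have "\<dots> = (\<Sum>x\<in>S. \<integral>v. l (\<Xi> v) * hit B x v \<partial>P) / card S"
    proof (subst Bochner_Integration.integral_divide_zero, subst Bochner_Integration.integral_sum)
      fix x assume "x \<in> S"
      then show "integrable P (\<lambda>v. l (\<Xi> v) * hit B x v)"
        using l1 \<Xi> SW B by (intro int1[of _ 1] borel_measurable_times lP hit_measurable)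
          (auto simp: hit_def indicator_def)
    qed simp
    also have "\<dots> = (\<integral>v. (l (\<Xi> v))\<^sup>2 \<partial>P)" using S by (simp add: hl)
    finally show ?thesis .
  qed
  let ?k2 = "\<lambda>\<xi>. (\<Sum>x\<in>S. \<Sum>y\<in>S. \<integral>u. hit B x u * hit B y u \<partial>\<kappa> \<xi>) / (card S)\<^sup>2"
  have ki: "integrable P (\<lambda>v. \<integral>u. hit B x u * hit B y u \<partial>\<kappa> (\<Xi> v))" if "x \<in> S" "y \<in> S" for x y
    by (rule int1[of _ 1], rule measurable_compose[OF \<Xi>_P measurable_kernel_hit2[OF _ _ B]])
      (use that SW in \<open>auto intro!: kernel_hit2_01[OF _ _ B] \<Xi>\<close>)
  \<comment> \<open>The second moment is disintegrated term by term over \<open>\<kappa>\<close>,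
    then bounded under each ergodic \<open>\<kappa> (\<Xi> v)\<close> by
    \<open>ergodic_avg_sq\<close>.\<close>
  have "expectation (\<lambda>v. (avg B S v)\<^sup>2) =
      (\<Sum>x\<in>S. \<Sum>y\<in>S. expectation (\<lambda>v. hit B x v * hit B y v)) / (card S)\<^sup>2"
    by (rule expectation_avg_sq[OF S(1,3) B])
  also have "\<dots> = (\<Sum>x\<in>S. \<Sum>y\<in>S. \<integral>v. (\<integral>u. hit B x u * hit B y u \<partial>\<kappa> (\<Xi> v)) \<partial>P) / (card S)\<^sup>2"
    using integral_kernel_hit2[OF _ _ B, of _ _ "\<lambda>_. 1" 1] SW
    by (intro arg_cong2[where f="(/)"] sum.cong refl) (simp add: subset_iff)
  also have "\<dots> = (\<integral>v. ?k2 (\<Xi> v) \<partial>P)"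
    using ki by (simp add: Bochner_Integration.integral_sum integrable_sum)
  also have "\<dots> \<le> (\<integral>v. (l (\<Xi> v))\<^sup>2 + \<delta> \<partial>P)"
  proof (rule integral_mono_AE)
    show "integrable P (\<lambda>v. ?k2 (\<Xi> v))" using ki by (intro integrable_divide_zero integrable_sum) auto
    show "integrable P (\<lambda>v. (l (\<Xi> v))\<^sup>2 + \<delta>)" using il by simp
    show "AE v in P. ?k2 (\<Xi> v) \<le> (l (\<Xi> v))\<^sup>2 + \<delta>"
      using AE_ergodic AE_space
    proof eventually_elim
      fix v assume v: "ergodic_measure W G (\<kappa> (\<Xi> v))" "v \<in> space P"
      interpret k: orbit_law "\<kappa> (\<Xi> v)" W L G X by (rule orbit_law_\<kappa>[OF \<Xi>[OF v(2)] v(1)])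
      show "?k2 (\<Xi> v) \<le> (l (\<Xi> v))\<^sup>2 + \<delta>"
        using k.ergodic_avg_sq[OF v(1) B S x0 fin]
        unfolding k.expectation_avg_sq[OF S(1,3) B] l_def measure_dir[OF \<Xi>[OF v(2)] B] \<delta>_def .
    qed
  qed
  also have "\<dots> = (\<integral>v. (l (\<Xi> v))\<^sup>2 \<partial>P) + \<delta>" using il by (simp add: prob_space)
  finally have Ea: "expectation (\<lambda>v. (avg B S v)\<^sup>2) \<le> (\<integral>v. (l (\<Xi> v))\<^sup>2 \<partial>P) + \<delta>" .
  have ia: "integrable P (\<lambda>v. (avg B S v)\<^sup>2)"
    using aP al by (intro int1[of _ 1] borel_measurable_power sq1)
  have ila: "integrable P (\<lambda>v. l (\<Xi> v) * avg B S v)"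
    using aP lP al l1 \<Xi>
    by (intro int1[of _ 1] borel_measurable_times) (auto simp: abs_mult intro!: mult_le_one)
  have eq: "(avg B S v - l (\<Xi> v))\<^sup>2 = (avg B S v)\<^sup>2 - 2 * (l (\<Xi> v) * avg B S v) + (l (\<Xi> v))\<^sup>2" for v
    by (simp add: power2_diff)
  have "integrable P (\<lambda>v. (avg B S v - l (\<Xi> v))\<^sup>2)"
    unfolding eq using ia ila il by simp
  moreover have "integrable P (\<lambda>v. avg B S v - l (\<Xi> v))"
  proof (rule int1[of _ 2])
    fix v assume "v \<in> space P"
    then show "\<bar>avg B S v - l (\<Xi> v)\<bar> \<le> 2" using al[of v] l1[OF \<Xi>, of v] by simp
  qed (intro borel_measurable_diff aP lP)
  moreover have "expectation (\<lambda>v. (avg B S v - l (\<Xi> v))\<^sup>2) \<le> \<delta>"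
    unfolding eq using ia ila il El Ea by simp
  ultimately show ?thesis
    unfolding l_def[symmetric] \<delta>_def[symmetric]
    by (intro order_trans[OF expectation_abs_le_sqrt real_sqrt_le_mono])
qed



section \<open>Conditional independence under the original law\<close>

text \<open>The events \<open>h < q\<close> for rational \<open>q\<close> are invariant up to null
  sets. The countably many exceptional sets can be united, and rational thresholds determine the
  value of \<open>h\<close>.\<close>

lemma H_invariant:
  fixes h :: "_ \<Rightarrow> real"
  assumes h: "h \<in> borel_measurable H" and \<pi>: "\<pi> \<in> G"
  shows "AE v in P. h (act W \<pi> v) = h v"
proof -
  have spH: "space H = space P" using subalgebra_H by (simp add: subalgebra_def)
  have "AE v in P. \<forall>q\<in>\<rat>. h (act W \<pi> v) < q \<longleftrightarrow> h v < q"
  proof (subst AE_ball_countable[OF countable_rat], intro ballI)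
    fix q :: real
    have "{v \<in> space H. h v < q} \<in> sets H" using h by measurable
    then have "ae_invariant W G P {v \<in> space H. h v < q}"
      using version by (simp add: inv_field_version_def)
    then have "AE v in P. act W \<pi> v \<in> {v \<in> space H. h v < q} \<longleftrightarrow> v \<in> {v \<in> space H. h v < q}"
      using \<pi> unfolding ae_invariant_def by blast
    then show "AE v in P. h (act W \<pi> v) < q \<longleftrightarrow> h v < q"
      using AE_space
      by eventually_elim (use measurable_space[OF act_measurable[OF \<pi>]] spH in auto)
  qed
  then show ?thesis
  proof eventually_elim
    fix v assume *: "\<forall>q\<in>\<rat>. h (act W \<pi> v) < q \<longleftrightarrow> h v < q"
    show "h (act W \<pi> v) = h v"
    proof (rule ccontr)
      assume "h (act W \<pi> v) \<noteq> h v"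
      then consider "h (act W \<pi> v) < h v" | "h v < h (act W \<pi> v)" by linarith
      then show False
      proof cases
        case 1
        then obtain q where "q \<in> \<rat>" "h (act W \<pi> v) < q" "q < h v"
          using Rats_dense_in_real by blast
        with * show False by (metis less_asym)
      next
        case 2
        then obtain q where "q \<in> \<rat>" "h v < q" "q < h (act W \<pi> v)"
          using Rats_dense_in_real by blast
        with * show False by (metis less_asym)
      qed
    qed
  qed
qed

lemma prod_hit_measurable:
  assumes "J \<subseteq> X" "\<And>j. j \<in> J \<Longrightarrow> Bs j \<in> sets (label_space L)"
  shows "(\<lambda>v. \<Prod>j\<in>J. hit (Bs j) j v) \<in> borel_measurable P"
  using assms X_sub by (intro borel_measurable_prod hit_measurable) auto

lemma prod_hit_01: "0 \<le> (\<Prod>j\<in>J. hit (Bs j) j v)" "(\<Prod>j\<in>J. hit (Bs j) j v) \<le> 1"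
  by (auto intro!: prod_nonneg prod_le_1 simp: hit_01)

text \<open>Since \<open>h\<close> is almost surely unchanged by \<open>G\<close>, a permutation
  fixing \<open>J\<close> pointwise and sending \<open>x\<close> to \<open>y\<close> transforms one
  integrand into the other, and its action preserves \<open>P\<close>.\<close>

lemma expectation_swap_hit:
  fixes h :: "_ \<Rightarrow> real"
  assumes h: "h \<in> borel_measurable H"
    and J: "finite J" "J \<subseteq> X" and Bs: "\<And>j. j \<in> J \<Longrightarrow> Bs j \<in> sets (label_space L)"
    and xy: "x \<in> X - J" "y \<in> X - J" and B: "B \<in> sets (label_space L)"
  shows "expectation (\<lambda>v. h v * (\<Prod>j\<in>J. hit (Bs j) j v) * hit B x v) =
    expectation (\<lambda>v. h v * (\<Prod>j\<in>J. hit (Bs j) j v) * hit B y v)"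
proof -
  define F where "F z v = h v * (\<Prod>j\<in>J. hit (Bs j) j v) * hit B z v" for z v
  have hP: "h \<in> borel_measurable P" by (rule measurable_from_subalg[OF subalgebra_H h])
  have FP: "F z \<in> borel_measurable P" if "z \<in> X" for z
    unfolding F_def using that X_sub
    by (intro borel_measurable_times hP prod_hit_measurable J Bs hit_measurable B) auto
  \<comment> \<open>The map that moves only \<open>x\<close> is injective on
    \<open>insert x J\<close> because \<open>y\<close> lies outside \<open>J\<close>.\<close>
  obtain \<pi> where \<pi>: "\<pi> \<in> G" "\<forall>j\<in>insert x J. \<pi> j = (if j = x then y else j)"
  proof -
    have "inj_on (\<lambda>j. if j = x then y else j) (insert x J)" "(\<lambda>j. if j = x then y else j) ` insert x J \<subseteq> X"
      using J xy by (auto simp: inj_on_def)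
    then show ?thesis
      using ext_property_extends[OF ext, of "insert x J"] J xy that by blast
  qed
  have fixJ: "act W \<pi> v j = v j" if "j \<in> J" for v j
  proof -
    have "\<pi> j = j" using \<pi>(2) that xy by auto
    then show ?thesis using act_apply[OF bij[OF \<pi>(1)], of j v] that J X_sub by auto
  qed
  have xy': "act W \<pi> v y = v x" for v
    using act_apply[OF bij[OF \<pi>(1)], of x v] \<pi>(2) xy X_sub by auto
  have "expectation (F y) = expectation (\<lambda>v. F y (act W \<pi> v))"
    using integral_act[OF \<pi>(1) FP] xy by simp
  also have "\<dots> = expectation (F x)"
  proof (rule integral_cong_AE)
    show "AE v in P. F y (act W \<pi> v) = F x v"
      using H_invariant[OF h \<pi>(1)]
      by eventually_elim (simp add: F_def hit_def fixJ xy')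
    show "(\<lambda>v. F y (act W \<pi> v)) \<in> borel_measurable P"
      using xy by (intro measurable_compose[OF act_measurable[OF \<pi>(1)] FP]) auto
    show "F x \<in> borel_measurable P" using FP xy by auto
  qed
  finally show ?thesis by (simp only: F_def[abs_def])
qed

text \<open>The indicator at \<open>x\<close> may be replaced by an average over worlds outside
  \<open>J\<close>, by \<open>expectation_swap_hit\<close>, and the average by the directing
  probability, by \<open>avg_dir_L1\<close>. The set averaged over must avoid \<open>J\<close>,
  while in a finite orbit it must be all of \<open>X\<close>; this explains
  \<open>fin\<close>.\<close>

lemma replace_hit:
  fixes h :: "_ \<Rightarrow> real"
  assumes h: "h \<in> borel_measurable H" and h1: "\<And>v. v \<in> space P \<Longrightarrow> \<bar>h v\<bar> \<le> 1"
    and J: "finite J" "J \<subseteq> X" and Bs: "\<And>j. j \<in> J \<Longrightarrow> Bs j \<in> sets (label_space L)"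
    and x: "x \<in> X - J" and B: "B \<in> sets (label_space L)"
    and fin: "infinite X \<or> J = {}"
  shows "expectation (\<lambda>v. h v * (\<Prod>j\<in>J. hit (Bs j) j v) * hit B x v) =
    expectation (\<lambda>v. h v * (\<Prod>j\<in>J. hit (Bs j) j v) * measure (dir (\<Xi> v)) B)"
proof -
  define g where "g = (\<lambda>v. h v * (\<Prod>j\<in>J. hit (Bs j) j v))"
  define l where "l = (\<lambda>v. measure (dir (\<Xi> v)) B)"
  have \<Xi>: "v \<in> space P \<Longrightarrow> \<Xi> v \<in> space E" for v using measurable_space[OF \<Xi>_P] .
  have hP: "h \<in> borel_measurable P" by (rule measurable_from_subalg[OF subalgebra_H h])
  have gP: "g \<in> borel_measurable P"
    unfolding g_def by (intro borel_measurable_times hP prod_hit_measurable J Bs)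
  have g1: "\<bar>g v\<bar> \<le> 1" if "v \<in> space P" for v
    unfolding g_def abs_mult using h1[OF that] prod_hit_01[where Bs=Bs and J=J and v=v] by (intro mult_le_one) auto
  have lP: "l \<in> borel_measurable P"
    unfolding l_def by (rule measurable_compose[OF \<Xi>_P measurable_measure_dir[OF B]])
  have l1: "\<bar>l v\<bar> \<le> 1" if "v \<in> space P" for v
    unfolding l_def by (rule measure_dir_01[OF \<Xi>[OF that]])
  have int: "integrable P (\<lambda>v. g v * f v)" if "f \<in> borel_measurable P" "\<And>v. v \<in> space P \<Longrightarrow> \<bar>f v\<bar> \<le> 1" for f
  proof (rule integrable_const_bound[where B=1, OF AE_I2])
    fix v assume "v \<in> space P"
    then show "norm (g v * f v) \<le> 1"
      unfolding real_norm_def abs_mult using g1 that(2) by (intro mult_le_one) auto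
  qed (intro borel_measurable_times gP that(1))
  have hitP: "hit B z \<in> borel_measurable P" if "z \<in> X" for z
    using that X_sub by (intro hit_measurable B) auto
  have bound: "\<bar>expectation (\<lambda>v. g v * hit B x v) - expectation (\<lambda>v. g v * l v)\<bar>
      \<le> sqrt (if finite X then 0 else 1 / card S)"
    if S: "finite S" "S \<noteq> {}" "S \<subseteq> X - J" "finite X \<Longrightarrow> S = X" for S
  proof -
    have SX: "S \<subseteq> X" using S by auto
    have aP: "avg B S \<in> borel_measurable P" using SX X_sub by (intro avg_measurable B) auto
    have a1: "\<bar>avg B S v\<bar> \<le> 1" for v using avg_01[of B S v] by simp
    have "expectation (\<lambda>v. g v * avg B S v) = expectation (\<lambda>v. (\<Sum>z\<in>S. g v * hit B z v) / card S)"
      by (simp add: avg_def sum_distrib_left)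
    also have "\<dots> = (\<Sum>z\<in>S. expectation (\<lambda>v. g v * hit B z v)) / card S"
      using SX by (subst Bochner_Integration.integral_divide_zero, subst Bochner_Integration.integral_sum)
        (auto intro!: int hitP simp: hit_01)
    also have "(\<Sum>z\<in>S. expectation (\<lambda>v. g v * hit B z v)) = (\<Sum>z\<in>S. expectation (\<lambda>v. g v * hit B x v))"
      unfolding g_def using S x by (intro sum.cong refl expectation_swap_hit h J Bs B) auto
    finally have "expectation (\<lambda>v. g v * hit B x v) = expectation (\<lambda>v. g v * avg B S v)"
      using S by simp
    then have "\<bar>expectation (\<lambda>v. g v * hit B x v) - expectation (\<lambda>v. g v * l v)\<bar> =
        \<bar>expectation (\<lambda>v. g v * (avg B S v - l v))\<bar>"
      using int[OF aP a1] int[OF lP l1] by (simp add: right_diff_distrib)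
    also have "\<dots> \<le> expectation (\<lambda>v. \<bar>g v * (avg B S v - l v)\<bar>)"
      by (rule integral_abs_bound)
    also have "\<dots> \<le> expectation (\<lambda>v. \<bar>avg B S v - l v\<bar>)"
    proof (rule integral_mono)
      have "integrable P (\<lambda>v. g v * avg B S v - g v * l v)" using int[OF aP a1] int[OF lP l1] by simp
      then show "integrable P (\<lambda>v. \<bar>g v * (avg B S v - l v)\<bar>)" by (simp add: right_diff_distrib)
      show "integrable P (\<lambda>v. \<bar>avg B S v - l v\<bar>)"
      proof (rule integrable_const_bound[where B=2, OF AE_I2])
        fix v assume "v \<in> space P"
        then show "norm \<bar>avg B S v - l v\<bar> \<le> 2" using a1[of v] l1[of v] by simp
      qed (intro borel_measurable_abs borel_measurable_diff aP lP)
      fix v assume "v \<in> space P"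
      then show "\<bar>g v * (avg B S v - l v)\<bar> \<le> \<bar>avg B S v - l v\<bar>"
        using g1 by (simp add: abs_mult mult_left_le_one_le)
    qed
    also have "\<dots> \<le> sqrt (if finite X then 0 else 1 / card S)"
      unfolding l_def by (rule avg_dir_L1[OF B S(1,2) SX S(4)])
    finally show ?thesis .
  qed
  \<comment> \<open>A finite \<open>X\<close> forces \<open>J = {}\<close> and is averaged as a
    whole, with bound 0; otherwise ever larger sets outside \<open>J\<close> send the bound to
    0.\<close>
  have "\<bar>expectation (\<lambda>v. g v * hit B x v) - expectation (\<lambda>v. g v * l v)\<bar> \<le> 0"
  proof (cases "finite X")
    case True
    then show ?thesis using bound[of X] fin x by auto
  next
    case False
    have "\<bar>expectation (\<lambda>v. g v * hit B x v) - expectation (\<lambda>v. g v * l v)\<bar> \<le> sqrt (1 / Suc n)" for n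
    proof -
      obtain S where "S \<subseteq> X - J" "finite S" "card S = Suc n"
        using infinite_arbitrarily_large[of "X - J" "Suc n"] False J(1) by auto
      then show ?thesis using bound[of S] False by (cases "S = {}") auto
    qed
    moreover have "(\<lambda>n. sqrt (1 / Suc n)) \<longlonglongrightarrow> 0" by real_asymp
    ultimately show ?thesis by (intro LIMSEQ_le_const) auto
  qed
  then show ?thesis by (simp add: g_def l_def)
qed

text \<open>Factors are removed one at a time. The directing probability that replaces a factor is
  \<open>H\<close>-measurable and is absorbed into \<open>h\<close>, so the induction has to keep
  \<open>h\<close> arbitrary.\<close>

lemma expectation_prod_hit:
  fixes h :: "_ \<Rightarrow> real"
  assumes X1: "infinite X \<or> card X = 1"
    and J: "finite J" "J \<subseteq> X" and Bs: "\<And>j. j \<in> J \<Longrightarrow> Bs j \<in> sets (label_space L)"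
    and h: "h \<in> borel_measurable H" and h1: "\<And>v. v \<in> space P \<Longrightarrow> \<bar>h v\<bar> \<le> 1"
  shows "expectation (\<lambda>v. h v * (\<Prod>j\<in>J. hit (Bs j) j v)) =
    expectation (\<lambda>v. h v * (\<Prod>j\<in>J. measure (dir (\<Xi> v)) (Bs j)))"
  using J Bs h h1
proof (induction J arbitrary: h rule: finite_induct)
  case empty
  show ?case by simp
next
  case (insert x J)
  have \<Xi>: "v \<in> space P \<Longrightarrow> \<Xi> v \<in> space E" for v using measurable_space[OF \<Xi>_P] .
  \<comment> \<open>In a one-world orbit, the inclusion of \<open>insert x J\<close> in
    \<open>X\<close> leaves \<open>J\<close> empty.\<close>
  have fin: "infinite X \<or> J = {}"
    using X1 insert.prems(1) insert.hyps by (auto simp: card_1_singleton_iff)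
  let ?l = "\<lambda>v. measure (dir (\<Xi> v)) (Bs x)"
  have lH: "?l \<in> borel_measurable H"
    using insert.prems by (intro measurable_compose[OF \<Xi>_H measurable_measure_dir]) auto
  have "expectation (\<lambda>v. h v * (\<Prod>j\<in>insert x J. hit (Bs j) j v)) =
      expectation (\<lambda>v. h v * (\<Prod>j\<in>J. hit (Bs j) j v) * hit (Bs x) x v)"
    using insert.hyps by (simp add: mult_ac)
  also have "\<dots> = expectation (\<lambda>v. h v * (\<Prod>j\<in>J. hit (Bs j) j v) * ?l v)"
    using insert.prems insert.hyps fin by (intro replace_hit) auto
  also have "\<dots> = expectation (\<lambda>v. (h v * ?l v) * (\<Prod>j\<in>J. hit (Bs j) j v))"
    by (simp add: mult_ac)
  also have "\<dots> = expectation (\<lambda>v. (h v * ?l v) * (\<Prod>j\<in>J. measure (dir (\<Xi> v)) (Bs j)))"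
  proof (rule insert.IH)
    show "(\<lambda>v. h v * ?l v) \<in> borel_measurable H"
      using insert.prems(3) lH by (rule borel_measurable_times)
    show "\<bar>h v * ?l v\<bar> \<le> 1" if "v \<in> space P" for v
      unfolding abs_mult using insert.prems(4)[OF that] measure_dir_01[OF \<Xi>[OF that]]
      by (intro mult_le_one) auto
  qed (use insert.prems in auto)
  also have "\<dots> = expectation (\<lambda>v. h v * (\<Prod>j\<in>insert x J. measure (dir (\<Xi> v)) (Bs j)))"
    using insert.hyps by (simp add: mult_ac)
  finally show ?case .
qed

text \<open>Indicators of events of \<open>F\<close> are among the test functions \<open>h\<close>,
  so one identity tested against \<open>H\<close> gives the conditional expectation for every
  \<open>F\<close> contained in \<open>H\<close> that makes \<open>g\<close> measurable.\<close>

lemma real_cond_exp_eqI: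
  assumes F: "subalgebra P F" "sets F \<subseteq> sets H"
    and A: "A \<in> sets P" and g: "g \<in> borel_measurable F" "\<And>v. v \<in> space P \<Longrightarrow> \<bar>g v\<bar> \<le> 1"
    and eq: "\<And>h. h \<in> borel_measurable H \<Longrightarrow> (\<And>v. \<bar>h v\<bar> \<le> 1) \<Longrightarrow>
      expectation (\<lambda>v. h v * indicator A v) = expectation (\<lambda>v. h v * g v)"
  shows "AE v in P. real_cond_exp P F (indicator A) v = g v"
proof -
  interpret F: finite_measure_subalgebra P F by standard (rule F(1))
  show ?thesis
  proof (rule F.real_cond_exp_charact[OF _ _ _ g(1)])
    show "integrable P (indicator A :: _ \<Rightarrow> real)"
      using A by (intro integrable_const_bound[where B=1]) auto
    show "integrable P g"
      using g(2) by (intro integrable_const_bound[where B=1] measurable_from_subalg[OF F(1) g(1)]) auto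
    fix C assume "C \<in> sets F"
    then have "(indicator C :: _ \<Rightarrow> real) \<in> borel_measurable H" using F(2) by auto
    from eq[OF this] show "(LINT v:C|P. indicator A v) = (LINT v:C|P. g v)"
      by (simp add: set_lebesgue_integral_def indicator_def)
  qed
qed

text \<open>Leaving \<open>F\<close> free treats \<open>H\<close>, the field of \<open>\<Xi>\<close>
  and the field of the directing law at once: \<open>expectation_prod_hit\<close> provides the
  identity against all of \<open>H\<close>, and \<open>F\<close> only has to make the directing law
  measurable.\<close>

lemma cond_iid_dir:
  assumes F: "subalgebra P F" "sets F \<subseteq> sets H" and X1: "infinite X \<or> card X = 1"
    and dF: "(\<lambda>v. dir (\<Xi> v)) \<in> measurable F (prob_algebra (label_space L))"
  shows "cond_iid P F (label_space L) X (\<lambda>v. dir (\<Xi> v))"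
  unfolding cond_iid_def
proof (intro allI impI, elim conjE)
  fix J Bs assume J: "finite J" "J \<subseteq> X" and "\<forall>j\<in>J. Bs j \<in> sets (label_space L)"
  then have Bs: "Bs j \<in> sets (label_space L)" if "j \<in> J" for j using that by blast
  have \<Xi>: "v \<in> space P \<Longrightarrow> \<Xi> v \<in> space E" for v using measurable_space[OF \<Xi>_P] .
  let ?A = "{v \<in> space P. \<forall>j\<in>J. v j \<in> Bs j}"
  have hA: "(\<Prod>j\<in>J. hit (Bs j) j v) = indicator ?A v" if "v \<in> space P" for v
  proof (cases "\<forall>j\<in>J. v j \<in> Bs j")
    case True
    then have "(\<Prod>j\<in>J. hit (Bs j) j v) = 1" by (intro prod.neutral) (simp add: hit_def)
    with True that show ?thesis by simp
  next
    case False
    then obtain j where "j \<in> J" "hit (Bs j) j v = 0" by (auto simp: hit_def)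
    then have "(\<Prod>j\<in>J. hit (Bs j) j v) = 0" using J(1) by (intro prod_zero) auto
    with False show ?thesis by simp
  qed
  show "AE v in P. real_cond_exp P F (indicator ?A) v = (\<Prod>j\<in>J. measure (dir (\<Xi> v)) (Bs j))"
  proof (rule real_cond_exp_eqI[OF F])
    have "(indicator ?A :: _ \<Rightarrow> real) \<in> borel_measurable P"
      by (rule measurable_cong[THEN iffD1, OF hA prod_hit_measurable[OF J(2) Bs]])
    then show "?A \<in> sets P" by (simp add: borel_measurable_indicator_iff Int_absorb2 subset_eq)
    show "(\<lambda>v. \<Prod>j\<in>J. measure (dir (\<Xi> v)) (Bs j)) \<in> borel_measurable F"
      using Bs by (intro borel_measurable_prod measurable_compose[OF dF measurable_measure_prob_algebra])
    show "\<bar>\<Prod>j\<in>J. measure (dir (\<Xi> v)) (Bs j)\<bar> \<le> 1" if "v \<in> space P" for v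
      unfolding abs_prod using measure_dir_01[OF \<Xi>[OF that]] by (intro prod_le_1) auto
    fix h :: "_ \<Rightarrow> real" assume h: "h \<in> borel_measurable H" "\<And>v. \<bar>h v\<bar> \<le> 1"
    have "expectation (\<lambda>v. h v * indicator ?A v) = expectation (\<lambda>v. h v * (\<Prod>j\<in>J. hit (Bs j) j v))"
      using hA by (intro Bochner_Integration.integral_cong) auto
    also have "\<dots> = expectation (\<lambda>v. h v * (\<Prod>j\<in>J. measure (dir (\<Xi> v)) (Bs j)))"
      by (rule expectation_prod_hit[OF X1 J Bs h])
    finally show "expectation (\<lambda>v. h v * indicator ?A v) =
      expectation (\<lambda>v. h v * (\<Prod>j\<in>J. measure (dir (\<Xi> v)) (Bs j)))" .
  qed
qed

text \<open>This is \<open>replace_hit\<close> with \<open>J\<close> empty, hence valid for orbits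
  of every size.\<close>

lemma cond_marginal:
  assumes w: "w \<in> X" and B: "B \<in> sets (label_space L)"
  shows "AE v in P. real_cond_exp P H (indicator {v \<in> space P. v w \<in> B}) v = measure (dir (\<Xi> v)) B"
proof (rule real_cond_exp_eqI[OF subalgebra_H order_refl])
  let ?A = "{v \<in> space P. v w \<in> B}"
  have hA: "hit B w v = indicator ?A v" if "v \<in> space P" for v
    using that by (auto simp: hit_def indicator_def)
  have "(indicator ?A :: _ \<Rightarrow> real) \<in> borel_measurable P"
    by (rule measurable_cong[THEN iffD1, OF hA hit_measurable[OF _ B]]) (use w X_sub in auto)
  then show "?A \<in> sets P" by (simp add: borel_measurable_indicator_iff Int_absorb2 subset_eq)
  show "(\<lambda>v. measure (dir (\<Xi> v)) B) \<in> borel_measurable H"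
    by (rule measurable_compose[OF \<Xi>_H measurable_measure_dir[OF B]])
  show "\<bar>measure (dir (\<Xi> v)) B\<bar> \<le> 1" if "v \<in> space P" for v
    by (rule measure_dir_01[OF measurable_space[OF \<Xi>_P that]])
  fix h :: "_ \<Rightarrow> real" assume h: "h \<in> borel_measurable H" "\<And>v. \<bar>h v\<bar> \<le> 1"
  have "expectation (\<lambda>v. h v * indicator ?A v) = expectation (\<lambda>v. h v * hit B w v)"
    using hA by (intro Bochner_Integration.integral_cong) auto
  also have "\<dots> = expectation (\<lambda>v. h v * measure (dir (\<Xi> v)) B)"
    using replace_hit[OF h, of "{}" "\<lambda>_. {}" w B] w B by simp
  finally show "expectation (\<lambda>v. h v * indicator ?A v) = expectation (\<lambda>v. h v * measure (dir (\<Xi> v)) B)" .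
qed

text \<open>With \<open>L\<close> finite there are finitely many label events, so the null sets from
  \<open>H_invariant\<close> can be united; equality on all events is equality of measures.\<close>

lemma dir_invariant:
  assumes \<pi>: "\<pi> \<in> G" and L: "finite L"
  shows "AE v in P. dir (\<Xi> (act W \<pi> v)) = dir (\<Xi> v)"
proof -
  have "finite (L \<rightarrow>\<^sub>E (UNIV :: bool set))" using L by (intro finite_PiE) auto
  then have fin: "finite (sets (label_space L))" by (simp add: label_space_def)
  have "AE v in P. \<forall>B\<in>sets (label_space L). measure (dir (\<Xi> (act W \<pi> v))) B = measure (dir (\<Xi> v)) B"
    by (intro AE_finite_allI fin H_invariant[OF _ \<pi>]
        measurable_compose[OF \<Xi>_H measurable_measure_dir])
  then show ?thesis
    using AE_space
  proof eventually_elim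
    fix v assume eq: "\<forall>B\<in>sets (label_space L). measure (dir (\<Xi> (act W \<pi> v))) B = measure (dir (\<Xi> v)) B"
      and v: "v \<in> space P"
    have sp: "dir (\<Xi> u) \<in> space (prob_algebra (label_space L))" if "u \<in> space P" for u
      using measurable_space[OF \<Xi>_P that] measurable_space[OF measurable_dir] by blast
    have u: "act W \<pi> v \<in> space P" by (rule measurable_space[OF act_measurable[OF \<pi>] v])
    interpret a: prob_space "dir (\<Xi> v)" using sp[OF v] by (simp add: space_prob_algebra)
    interpret b: prob_space "dir (\<Xi> (act W \<pi> v))" using sp[OF u] by (simp add: space_prob_algebra)
    show "dir (\<Xi> (act W \<pi> v)) = dir (\<Xi> v)"
      by (rule measure_eqI) (use eq sp[OF u] sp[OF v] in
        \<open>auto simp: space_prob_algebra a.emeasure_eq_measure b.emeasure_eq_measure\<close>)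
  qed
qed

end

section \<open>Dependent orbits\<close>

text \<open>A product measure is determined by cylinders. On a cylinder both sides are 1 when
  \<open>x\<close> lies in each of its factors and 0 otherwise.\<close>

lemma PiM_return_const:
  assumes x: "x \<in> space N"
  shows "PiM I (\<lambda>_. return N x) = return (PiM I (\<lambda>_. N)) (\<lambda>i\<in>I. x)"
proof -
  interpret product_prob_space "\<lambda>_. return N x" I
    by (rule product_prob_spaceI) (rule prob_space_return[OF x])
  have sets: "sets (PiM I (\<lambda>_. return N x)) = sets (PiM I (\<lambda>_. N))"
    by (rule sets_PiM_cong) auto
  show ?thesis
  proof (rule PiM_eq[symmetric])
    show "sets (return (PiM I (\<lambda>_. N)) (\<lambda>i\<in>I. x)) = sets (PiM I (\<lambda>_. return N x))"
      using sets by simp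
    fix J F assume J: "finite J" "J \<subseteq> I" and F: "\<And>j. j \<in> J \<Longrightarrow> F j \<in> sets (return N x)"
    let ?E = "prod_emb I (\<lambda>_. return N x) J (\<Pi>\<^sub>E j\<in>J. F j)"
    have "?E \<in> sets (PiM I (\<lambda>_. return N x))"
      using J F by (intro sets_PiM_I) auto
    then have "emeasure (return (PiM I (\<lambda>_. N)) (\<lambda>i\<in>I. x)) ?E = indicator ?E (\<lambda>i\<in>I. x)"
      using sets by simp
    also have "\<dots> = (\<Prod>j\<in>J. indicator (F j) x)"
    proof (cases "\<forall>j\<in>J. x \<in> F j")
      case True
      then have "(\<lambda>i\<in>I. x) \<in> ?E" using J x by (auto simp: prod_emb_def PiE_iff subset_iff)
      moreover have "(\<Prod>j\<in>J. indicator (F j) x) = (1::ennreal)"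
        using True by (intro prod.neutral) simp
      ultimately show ?thesis by simp
    next
      case False
      then obtain j where j: "j \<in> J" "x \<notin> F j" by blast
      then have "(\<lambda>i\<in>I. x) \<notin> ?E" using J by (auto simp: prod_emb_def PiE_iff subset_iff)
      moreover have "(\<Prod>j\<in>J. indicator (F j) x) = (0::ennreal)"
        using j J(1) by (intro prod_zero bexI[of _ j]) auto
      ultimately show ?thesis by simp
    qed
    also have "\<dots> = (\<Prod>j\<in>J. emeasure (return N x) (F j))"
      using F by (intro prod.cong) auto
    finally show "emeasure (return (PiM I (\<lambda>_. N)) (\<lambda>i\<in>I. x)) ?E = (\<Prod>j\<in>J. emeasure (return N x) (F j))" .
  qed
qed

lemma act_const:
  assumes "bij_betw \<pi> W W"
  shows "act W \<pi> (\<lambda>w\<in>W. \<xi>) = (\<lambda>w\<in>W. \<xi>)"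
proof -
  have "inv_into W \<pi> w \<in> W" if "w \<in> W" for w
    using assms that by (metis bij_betw_def inv_into_into)
  then show ?thesis by (auto simp: act_def fun_eq_iff restrict_def)
qed

lemma const_in_val_space: "\<xi> \<in> space (label_space L) \<Longrightarrow> (\<lambda>w\<in>W. \<xi>) \<in> space (val_space W L)"
  by (auto simp: val_space_def space_PiM)

text \<open>A world fixed by \<open>G\<close> has a strictly invariant label. In the example this
  world is \<open>w0\<close>, which makes \<open>\<Xi>'\<close> measurable for the smallest version
  of the invariant field.\<close>

lemma measurable_inv_field_eval:
  assumes bij: "\<And>\<pi>. \<pi> \<in> G \<Longrightarrow> bij_betw \<pi> W W" and fp: "\<And>\<pi>. \<pi> \<in> G \<Longrightarrow> \<pi> w = w" and w: "w \<in> W"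
  shows "(\<lambda>v. v w) \<in> measurable (inv_field W L G) (label_space L)"
proof (rule measurableI)
  have m: "(\<lambda>v. v w) \<in> measurable (val_space W L) (label_space L)"
    unfolding val_space_def by (rule measurable_component_singleton[OF w])
  show "v w \<in> space (label_space L)" if "v \<in> space (inv_field W L G)" for v
    using measurable_space[OF m] that by (simp add: space_inv_field)
  fix B assume "B \<in> sets (label_space L)"
  then have B: "(\<lambda>v. v w) -` B \<inter> space (val_space W L) \<in> sets (val_space W L)"
    by (rule measurable_sets[OF m])
  have "act W \<pi> v w = v w" if "\<pi> \<in> G" for \<pi> and v :: "_ \<Rightarrow> _ \<Rightarrow> bool"
    using act_apply[OF bij[OF that] w, of v] fp[OF that] by simp
  then have "act W \<pi> -` ((\<lambda>v. v w) -` B \<inter> space (val_space W L)) \<inter> space (val_space W L) =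
      (\<lambda>v. v w) -` B \<inter> space (val_space W L)" if "\<pi> \<in> G" for \<pi>
    using that act_in_space[OF bij[OF that]] by auto
  with B show "(\<lambda>v. v w) -` B \<inter> space (inv_field W L G) \<in> sets (inv_field W L G)"
    by (simp add: sets_inv_field[OF bij] space_inv_field)
qed

text \<open>A constant valuation is a fixed point of the action, whence invariance; a point mass
  takes only the values 0 and 1, whence ergodicity.\<close>

lemma ergodic_return_const:
  assumes bij: "\<And>\<pi>. \<pi> \<in> G \<Longrightarrow> bij_betw \<pi> W W" and \<xi>: "\<xi> \<in> space (label_space L)"
  shows "ergodic_measure W G (return (val_space W L) (\<lambda>w\<in>W. \<xi>))"
  unfolding ergodic_measure_def
proof (intro conjI ballI impI)
  show "prob_space (return (val_space W L) (\<lambda>w\<in>W. \<xi>))"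
    by (rule prob_space_return[OF const_in_val_space[OF \<xi>]])
  show "invariant_measure W G (return (val_space W L) (\<lambda>w\<in>W. \<xi>))"
    unfolding invariant_measure_def
  proof (intro ballI)
    fix \<pi> A assume \<pi>: "\<pi> \<in> G" and A: "A \<in> sets (return (val_space W L) (\<lambda>w\<in>W. \<xi>))"
    have "act W \<pi> -` A \<inter> space (val_space W L) \<in> sets (val_space W L)"
      using A by (intro measurable_sets[OF measurable_act[OF bij[OF \<pi>]]]) simp
    then show "measure (return (val_space W L) (\<lambda>w\<in>W. \<xi>)) (act W \<pi> -` A \<inter> space (return (val_space W L) (\<lambda>w\<in>W. \<xi>)))
        = measure (return (val_space W L) (\<lambda>w\<in>W. \<xi>)) A"
      using A const_in_val_space[OF \<xi>, of W]
      by (simp add: measure_return indicator_def act_const[OF bij[OF \<pi>]])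
  qed
qed (auto simp: measure_return indicator_def)

text \<open>A fair coin gives every world the same label, so the labels of \<open>X\<close> and
  \<open>Y\<close> are copies of each other. Given the coin everything is deterministic, hence a
  product of point masses, and the dependence sits entirely in the shared value
  \<open>\<xi>\<close>.\<close>

lemma dependent_orbits_example:
  fixes W :: "'w set" and L :: "'l set"
  assumes w0: "w0 \<in> W" and G: "G = stab W R w0" and L: "L \<noteq> {}"
    and X: "X \<subseteq> W" "X \<noteq> {}" and Y: "Y \<subseteq> W" "Y \<noteq> {}"
  shows "\<exists>(Q :: ('w \<Rightarrow> 'l \<Rightarrow> bool) measure)
      (E' :: ('l \<Rightarrow> bool) measure) (\<Xi>' :: ('w \<Rightarrow> 'l \<Rightarrow> bool) \<Rightarrow> ('l \<Rightarrow> bool))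
      (\<kappa>' :: ('l \<Rightarrow> bool) \<Rightarrow> ('w \<Rightarrow> 'l \<Rightarrow> bool) measure)
      (M :: 'w set \<Rightarrow> ('l \<Rightarrow> bool) \<Rightarrow> ('l \<Rightarrow> bool) measure).
      prob_space Q \<and> sets Q = sets (val_space W L) \<and>
      modally_exchangeable W R w0 Q \<and>
      ergodic_decomposition W L G Q (inv_field W L G) E' \<Xi>' \<kappa>' \<and>
      \<not> prob_space.indep_var Q
          (val_space X L) (\<lambda>v. restrict v X) (val_space Y L) (\<lambda>v. restrict v Y) \<and>
      M X \<in> measurable E' (prob_algebra (label_space L)) \<and>
      M Y \<in> measurable E' (prob_algebra (label_space L)) \<and>
      (AE \<xi> in distr Q E' \<Xi>'.
         distr (\<kappa>' \<xi>) (val_space (X \<union> Y) L) (\<lambda>v. restrict v (X \<union> Y)) =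
         PiM (X \<union> Y) (\<lambda>w. if w \<in> X then M X \<xi> else M Y \<xi>))"
proof -
  \<comment> \<open>The two labels make all atoms true or all atoms false; they differ because
    \<open>L\<close> is nonempty.\<close>
  define t where "t = (\<lambda>b. \<lambda>l\<in>L. b :: bool)"
  define c where "c = (\<lambda>\<xi>. \<lambda>w\<in>W. \<xi> :: 'l \<Rightarrow> bool)"
  define N where "N = measure_pmf (bernoulli_pmf (1/2))"
  define Q where "Q = distr N (val_space W L) (\<lambda>b. c (t b))"
  \<comment> \<open>The label at \<open>w0\<close> reveals the coin, and the stabilizer fixes
    \<open>w0\<close>.\<close>
  define \<Xi>' where "\<Xi>' = (\<lambda>v :: 'w \<Rightarrow> 'l \<Rightarrow> bool. v w0)"
  define \<kappa>' where "\<kappa>' = (\<lambda>\<xi>. return (val_space W L) (c \<xi>))"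
  \<comment> \<open>The point mass at the common label serves as directing law for both sets of
    worlds.\<close>
  define M where "M = (\<lambda>(_ :: 'w set) \<xi>. return (label_space L) \<xi>)"
  interpret N: prob_space N unfolding N_def by (rule measure_pmf.prob_space_axioms)
  have bij: "bij_betw \<pi> W W" if "\<pi> \<in> G" for \<pi> using that G stab_bij by metis
  have t: "t b \<in> space (label_space L)" for b by (auto simp: t_def space_label_space)
  have c: "c \<xi> \<in> space (val_space W L)" if "\<xi> \<in> space (label_space L)" for \<xi>
    unfolding c_def by (rule const_in_val_space[OF that])
  have ct: "(\<lambda>b. c (t b)) \<in> measurable N (val_space W L)"
    using c t by (simp add: N_def)
  have tN: "t \<in> measurable N (label_space L)"
    using t by (simp add: N_def)
  have Q: "prob_space Q" unfolding Q_def by (rule N.prob_space_distr[OF ct])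
  interpret Q: prob_space Q by (rule Q)
  have setsQ: "sets Q = sets (val_space W L)" by (simp add: Q_def)
  have spQ: "space Q = space (val_space W L)" by (simp add: Q_def)
  have mQ: "measure Q A = measure N {b. c (t b) \<in> A}" if "A \<in> sets (val_space W L)" for A
    unfolding Q_def by (subst measure_distr[OF ct that]) (simp add: N_def vimage_def)
  have eQ: "emeasure Q A = emeasure N {b. c (t b) \<in> A}" if "A \<in> sets (val_space W L)" for A
    unfolding Q_def by (subst emeasure_distr[OF ct that]) (simp add: N_def vimage_def)
  have inv: "invariant_measure W G Q"
    unfolding invariant_measure_def
  proof (intro ballI)
    fix \<pi> A assume \<pi>: "\<pi> \<in> G" and A: "A \<in> sets Q"
    have "act W \<pi> -` A \<inter> space (val_space W L) \<in> sets (val_space W L)"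
      using A setsQ by (intro measurable_sets[OF measurable_act[OF bij[OF \<pi>]]]) simp
    then have "measure Q (act W \<pi> -` A \<inter> space Q) =
        measure N {b. c (t b) \<in> act W \<pi> -` A \<inter> space (val_space W L)}"
      unfolding spQ by (rule mQ)
    also have "\<dots> = measure Q A"
    proof -
      have "act W \<pi> (c \<xi>) = c \<xi>" for \<xi> unfolding c_def by (rule act_const[OF bij[OF \<pi>]])
      then show ?thesis using A setsQ c[OF t] by (simp add: mQ)
    qed
    finally show "measure Q (act W \<pi> -` A \<inter> space Q) = measure Q A" .
  qed
  have \<Xi>': "\<Xi>' \<in> measurable (inv_field W L G) (label_space L)"
    unfolding \<Xi>'_def using stab_fix w0 G by (intro measurable_inv_field_eval bij) auto
  have \<Xi>'Q: "\<Xi>' \<in> measurable Q (label_space L)"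
  proof -
    have "\<Xi>' \<in> measurable (val_space W L) (label_space L)"
      unfolding \<Xi>'_def val_space_def by (rule measurable_component_singleton[OF w0])
    then show ?thesis using measurable_cong_sets[OF setsQ refl] by blast
  qed
  have \<Xi>'c: "\<Xi>' (c \<xi>) = \<xi>" for \<xi> using w0 by (simp add: \<Xi>'_def c_def)
  have dQ: "distr Q (label_space L) \<Xi>' = distr N (label_space L) t"
  proof -
    have "\<Xi>' \<in> measurable (val_space W L) (label_space L)"
      unfolding \<Xi>'_def val_space_def by (rule measurable_component_singleton[OF w0])
    then show ?thesis unfolding Q_def by (subst distr_distr[OF _ ct]) (simp_all add: comp_def \<Xi>'c)
  qed
  have \<kappa>': "\<kappa>' \<in> measurable (label_space L) (prob_algebra (val_space W L))"
  proof -
    have "\<kappa>' \<xi> \<in> space (prob_algebra (val_space W L))" if "\<xi> \<in> space (label_space L)" for \<xi>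
      by (simp add: \<kappa>'_def space_prob_algebra prob_space_return[OF c[OF that]])
    then show ?thesis
      unfolding label_space_def measurable_count_space_eq1 by (intro funcsetI) simp
  qed
  have "ergodic_decomposition W L G Q (inv_field W L G) (label_space L) \<Xi>' \<kappa>'"
    unfolding ergodic_decomposition_def
  proof (intro conjI \<Xi>' \<kappa>' ballI)
    show "AE \<xi> in distr Q (label_space L) \<Xi>'. ergodic_measure W G (\<kappa>' \<xi>)"
      unfolding \<kappa>'_def c_def by (intro AE_I2 ergodic_return_const bij) auto
    fix A B assume A: "A \<in> sets Q" and B: "B \<in> sets (label_space L)"
    have AB: "A \<inter> (\<Xi>' -` B \<inter> space Q) \<in> sets (val_space W L)"
      using A measurable_sets[OF \<Xi>'Q B] setsQ by auto
    have "(\<integral>\<^sup>+ \<xi>\<in>B. emeasure (\<kappa>' \<xi>) A \<partial>distr Q (label_space L) \<Xi>') =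
        (\<integral>\<^sup>+ b. emeasure (\<kappa>' (t b)) A * indicator B (t b) \<partial>N)"
      unfolding dQ by (subst nn_integral_distr[OF tN]) (simp_all add: label_space_def)
    also have "\<dots> = (\<integral>\<^sup>+ b. indicator {b. c (t b) \<in> A \<inter> (\<Xi>' -` B \<inter> space Q)} b \<partial>N)"
      using A setsQ c t by (intro nn_integral_cong) (auto simp: \<kappa>'_def indicator_def \<Xi>'c spQ)
    also have "\<dots> = emeasure Q (A \<inter> (\<Xi>' -` B \<inter> space Q))"
      unfolding eQ[OF AB] by (subst nn_integral_indicator) (simp_all add: N_def)
    finally show "emeasure Q (A \<inter> (\<Xi>' -` B \<inter> space Q)) =
        (\<integral>\<^sup>+ \<xi>\<in>B. emeasure (\<kappa>' \<xi>) A \<partial>distr Q (label_space L) \<Xi>')" by simp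
  qed
  moreover have "\<not> Q.indep_var (val_space X L) (\<lambda>v. restrict v X) (val_space Y L) (\<lambda>v. restrict v Y)"
  proof
    assume indep: "Q.indep_var (val_space X L) (\<lambda>v. restrict v X) (val_space Y L) (\<lambda>v. restrict v Y)"
    obtain x y where x: "x \<in> X" "x \<in> W" and y: "y \<in> Y" "y \<in> W" using X Y by blast
    have tt: "{t True} \<in> sets (label_space L)" using t by (simp add: label_space_def)
    have ev: "(\<lambda>v. v z) -` {t True} \<inter> space (val_space Z L) \<in> sets (val_space Z L)" if "z \<in> Z" for z and Z :: "'w set"
      unfolding val_space_def by (rule measurable_sets[OF measurable_component_singleton[OF that] tt])
    let ?A = "(\<lambda>v. v x) -` {t True} \<inter> space (val_space X L)"
    let ?B = "(\<lambda>v. v y) -` {t True} \<inter> space (val_space Y L)"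
    have t_eq: "t b = t True \<longleftrightarrow> b" for b using L by (auto simp: t_def fun_eq_iff restrict_def)
    have res: "restrict v Z \<in> space (val_space Z L)" if "v \<in> space (val_space W L)" "Z \<subseteq> W"
      for v and Z :: "'w set"
      using that by (auto simp: space_val_space PiE_iff subset_iff)
    have A: "(\<lambda>v. restrict v X) -` ?A \<inter> space Q = (\<lambda>v. v x) -` {t True} \<inter> space (val_space W L)"
      using res X(1) x by (auto simp: spQ)
    have B: "(\<lambda>v. restrict v Y) -` ?B \<inter> space Q = (\<lambda>v. v y) -` {t True} \<inter> space (val_space W L)"
      using res Y(1) y by (auto simp: spQ)
    have AB: "(\<lambda>v. (restrict v X, restrict v Y)) -` (?A \<times> ?B) \<inter> space Q =
        ((\<lambda>v. v x) -` {t True} \<inter> space (val_space W L)) \<inter> ((\<lambda>v. v y) -` {t True} \<inter> space (val_space W L))"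
      unfolding A[symmetric] B[symmetric] by auto
    have half: "measure N {True} = 1/2"
      by (simp add: N_def measure_pmf_single)
    have set1: "{b. c (t b) \<in> (\<lambda>v. v z) -` {t True} \<inter> space (val_space W L)} = {True}" if "z \<in> W" for z
      using that c t by (auto simp: c_def t_eq)
    have set2: "{b. c (t b) \<in> ((\<lambda>v. v x) -` {t True} \<inter> space (val_space W L)) \<inter>
        ((\<lambda>v. v y) -` {t True} \<inter> space (val_space W L))} = {True}"
      using set1[OF x(2)] set1[OF y(2)] by blast
    \<comment> \<open>Each of the two events says that the coin shows \<open>True\<close>, so the
      joint probability is 1/2 instead of the 1/4 that independence would require.\<close>
    have "measure Q (((\<lambda>v. v x) -` {t True} \<inter> space (val_space W L)) \<inter>
        ((\<lambda>v. v y) -` {t True} \<inter> space (val_space W L))) = 1/2"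
      by (subst mQ[OF sets.Int[OF ev[OF x(2)] ev[OF y(2)]]]) (simp only: set2 half)
    moreover have "measure Q ((\<lambda>v. v z) -` {t True} \<inter> space (val_space W L)) = 1/2" if "z \<in> W" for z
      by (subst mQ[OF ev[OF that]]) (simp only: set1[OF that] half)
    ultimately show False
      using Q.indep_varD[OF indep ev[OF x(1)] ev[OF y(1)]] x y unfolding A B AB by simp
  qed
  moreover have "M Z \<in> measurable (label_space L) (prob_algebra (label_space L))" for Z
    unfolding M_def by (rule measurable_return_prob_space)
  moreover have "AE \<xi> in distr Q (label_space L) \<Xi>'.
      distr (\<kappa>' \<xi>) (val_space (X \<union> Y) L) (\<lambda>v. restrict v (X \<union> Y)) =
      PiM (X \<union> Y) (\<lambda>w. if w \<in> X then M X \<xi> else M Y \<xi>)"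
  proof (rule AE_I2)
    fix \<xi> assume "\<xi> \<in> space (distr Q (label_space L) \<Xi>')"
    then have \<xi>: "\<xi> \<in> space (label_space L)" by simp
    have m: "(\<lambda>v. restrict v (X \<union> Y)) \<in> measurable (val_space W L) (val_space (X \<union> Y) L)"
      unfolding val_space_def using X Y by (intro measurable_restrict_subset) auto
    have "distr (\<kappa>' \<xi>) (val_space (X \<union> Y) L) (\<lambda>v. restrict v (X \<union> Y)) =
        return (val_space (X \<union> Y) L) (restrict (c \<xi>) (X \<union> Y))"
      unfolding \<kappa>'_def by (rule distr_return[OF m c[OF \<xi>]])
    also have "restrict (c \<xi>) (X \<union> Y) = (\<lambda>w\<in>X \<union> Y. \<xi>)"
      using X Y by (auto simp: c_def fun_eq_iff restrict_def)
    also have "return (val_space (X \<union> Y) L) (\<lambda>w\<in>X \<union> Y. \<xi>) = PiM (X \<union> Y) (\<lambda>w. if w \<in> X then M X \<xi> else M Y \<xi>)"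
      unfolding M_def val_space_def if_cancel by (rule PiM_return_const[OF \<xi>, symmetric])
    finally show "distr (\<kappa>' \<xi>) (val_space (X \<union> Y) L) (\<lambda>v. restrict v (X \<union> Y)) =
      PiM (X \<union> Y) (\<lambda>w. if w \<in> X then M X \<xi> else M Y \<xi>)" .
  qed
  ultimately show ?thesis
    using Q setsQ inv unfolding modally_exchangeable_def G by blast
qed

section \<open>Assembly over all orbits\<close>

theorem mainTheorem2:
  fixes W :: "'w set" and R :: "'w \<Rightarrow> 'w \<Rightarrow> bool" and w0 :: 'w and L :: "'l set"
    and G :: "('w \<Rightarrow> 'w) set"
    and P H :: "('w \<Rightarrow> 'l \<Rightarrow> bool) measure"
    and E :: "'x measure" and \<Xi> :: "('w \<Rightarrow> 'l \<Rightarrow> bool) \<Rightarrow> 'x"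
    and \<kappa> :: "'x \<Rightarrow> ('w \<Rightarrow> 'l \<Rightarrow> bool) measure"
  assumes "W \<noteq> {}" and "countable W"
    and "reflp_on W R" and "transp_on W R"
    and "w0 \<in> W"
    and G: "G = stab W R w0"
    and "finite L"
    and "prob_space P" and "sets P = sets (val_space W L)"
    and "modally_exchangeable W R w0 P"
    and "inv_field_version W L G P H"
    and "ergodic_decomposition W L G P H E \<Xi> \<kappa>"
    and "\<forall>X\<in>orbits W R w0. ext_property G X"
  shows "(\<exists>(\<Lambda> :: 'w set \<Rightarrow> ('w \<Rightarrow> 'l \<Rightarrow> bool) \<Rightarrow> ('l \<Rightarrow> bool) measure)
           (\<Lambda>' :: 'w set \<Rightarrow> 'x \<Rightarrow> ('l \<Rightarrow> bool) measure).
          (\<forall>X\<in>orbits W R w0.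
             \<Lambda> X \<in> measurable P (prob_algebra (label_space L)) \<and>
             \<Lambda>' X \<in> measurable E (prob_algebra (label_space L)) \<and>
             (\<forall>v\<in>space P. \<Lambda> X v = \<Lambda>' X (\<Xi> v)) \<and>
             \<comment> \<open>de Finetti's theorem fails for finite orbits with at least two worlds\<close>
             (infinite X \<or> card X = 1 \<longrightarrow>
                cond_iid P (generated_field P (\<Lambda> X) (prob_algebra (label_space L)))
                  (label_space L) X (\<Lambda> X) \<and>
                cond_iid P H (label_space L) X (\<Lambda> X) \<and>
                cond_iid P (generated_field P \<Xi> E) (label_space L) X (\<Lambda> X)) \<and>
             \<Lambda> X \<in> measurable H (prob_algebra (label_space L)) \<and>
             (\<forall>\<pi>\<in>G. \<pi> ` X = X \<longrightarrow> (AE v in P. \<Lambda> X (act W \<pi> v) = \<Lambda> X v)) \<and>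
             (\<forall>w\<in>X. \<forall>B\<in>sets (label_space L). AE v in P.
                real_cond_exp P H (indicator {v \<in> space P. v w \<in> B}) v = measure (\<Lambda> X v) B)))
       \<and>
       \<comment> \<open>dependence between any two orbits is possible, carried by their directing laws alone\<close>
       (L \<noteq> {} \<longrightarrow>
          (\<forall>X\<in>orbits W R w0. \<forall>Y\<in>orbits W R w0. X \<noteq> Y \<longrightarrow>
             (\<exists>(Q :: ('w \<Rightarrow> 'l \<Rightarrow> bool) measure)
                (E' :: ('l \<Rightarrow> bool) measure) (\<Xi>' :: ('w \<Rightarrow> 'l \<Rightarrow> bool) \<Rightarrow> ('l \<Rightarrow> bool))
                (\<kappa>' :: ('l \<Rightarrow> bool) \<Rightarrow> ('w \<Rightarrow> 'l \<Rightarrow> bool) measure)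
                (M :: 'w set \<Rightarrow> ('l \<Rightarrow> bool) \<Rightarrow> ('l \<Rightarrow> bool) measure).
                prob_space Q \<and> sets Q = sets (val_space W L) \<and>
                modally_exchangeable W R w0 Q \<and>
                ergodic_decomposition W L G Q (inv_field W L G) E' \<Xi>' \<kappa>' \<and>
                \<not> prob_space.indep_var Q
                    (val_space X L) (\<lambda>v. restrict v X) (val_space Y L) (\<lambda>v. restrict v Y) \<and>
                M X \<in> measurable E' (prob_algebra (label_space L)) \<and>
                M Y \<in> measurable E' (prob_algebra (label_space L)) \<and>
                (AE \<xi> in distr Q E' \<Xi>'.
                   distr (\<kappa>' \<xi>) (val_space (X \<union> Y) L) (\<lambda>v. restrict v (X \<union> Y)) =
                   PiM (X \<union> Y) (\<lambda>w. if w \<in> X then M X \<xi> else M Y \<xi>)))))"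
proof -
  define x0 where "x0 X = (SOME x. x \<in> X)" for X :: "'w set"
  \<comment> \<open>The constant \<open>dir\<close> depends on \<open>L\<close>,
    \<open>\<kappa>\<close> and the base world alone, so the whole family can be named before the
    locale is interpreted orbit by orbit.\<close>
  define \<Lambda>' where "\<Lambda>' X = decomposed_orbit_law.dir L \<kappa> (x0 X)" for X
  define \<Lambda> where "\<Lambda> X v = \<Lambda>' X (\<Xi> v)" for X v
  have main: "\<Lambda> X \<in> measurable P (prob_algebra (label_space L)) \<and>
      \<Lambda>' X \<in> measurable E (prob_algebra (label_space L)) \<and>
      (\<forall>v\<in>space P. \<Lambda> X v = \<Lambda>' X (\<Xi> v)) \<and>
      (infinite X \<or> card X = 1 \<longrightarrow>
         cond_iid P (generated_field P (\<Lambda> X) (prob_algebra (label_space L)))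
           (label_space L) X (\<Lambda> X) \<and>
         cond_iid P H (label_space L) X (\<Lambda> X) \<and>
         cond_iid P (generated_field P \<Xi> E) (label_space L) X (\<Lambda> X)) \<and>
      \<Lambda> X \<in> measurable H (prob_algebra (label_space L)) \<and>
      (\<forall>\<pi>\<in>G. \<pi> ` X = X \<longrightarrow> (AE v in P. \<Lambda> X (act W \<pi> v) = \<Lambda> X v)) \<and>
      (\<forall>w\<in>X. \<forall>B\<in>sets (label_space L). AE v in P.
         real_cond_exp P H (indicator {v \<in> space P. v w \<in> B}) v = measure (\<Lambda> X v) B)"
    if X: "X \<in> orbits W R w0" for X
  proof -
    have x0: "x0 X \<in> X" unfolding x0_def using orbits_nonempty[OF X] by (simp add: some_in_eq)
    interpret P: prob_space P by fact
    interpret D: decomposed_orbit_law P W L G X H E \<Xi> \<kappa> "x0 X"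
    proof
      show "sets P = sets (val_space W L)" "inv_field_version W L G P H"
        "ergodic_decomposition W L G P H E \<Xi> \<kappa>" "x0 X \<in> X"
        by fact+
      show "bij_betw \<pi> W W" if "\<pi> \<in> G" for \<pi> using that stab_bij G by auto
      show "invariant_measure W G P" using assms(10) G by (simp add: modally_exchangeable_def)
      show "X \<subseteq> W" by (rule orbits_subset[OF X])
      show "\<pi> ` X = X" if "\<pi> \<in> G" for \<pi> using that orbits_image[OF X \<open>w0 \<in> W\<close>] G by auto
      show "ext_property G X" using assms X by blast
    qed
    have \<Lambda>'X: "\<Lambda>' X = D.dir" and \<Lambda>X: "\<Lambda> X = (\<lambda>v. D.dir (\<Xi> v))"
      by (simp_all add: \<Lambda>'_def \<Lambda>_def[abs_def])
    have \<Lambda>H: "\<Lambda> X \<in> measurable H (prob_algebra (label_space L))"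
      unfolding \<Lambda>X by (rule measurable_compose[OF D.\<Xi>_H D.measurable_dir])
    have \<Lambda>P: "\<Lambda> X \<in> measurable P (prob_algebra (label_space L))"
      by (rule measurable_from_subalg[OF D.subalgebra_H \<Lambda>H])
    have spH: "space H = space P" using D.subalgebra_H by (simp add: subalgebra_def)
    \<comment> \<open>One statement serves two generated fields: \<open>f\<close> is
      \<open>\<Xi>\<close> with \<open>g\<close> the directing map, or \<open>f\<close> is
      \<open>\<Lambda> X\<close> with \<open>g\<close> the identity. In both, \<open>f\<close> is
      \<open>H\<close>-measurable and determines the directing law.\<close>
    have gen: "cond_iid P (generated_field P f F) (label_space L) X (\<Lambda> X)"
      if "infinite X \<or> card X = 1" and f: "f \<in> measurable H F" and \<Lambda>: "\<Lambda> X = (\<lambda>v. g (f v))"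
        and g: "g \<in> measurable F (prob_algebra (label_space L))" for f and F :: "'z measure" and g
    proof -
      have fs: "f \<in> space P \<rightarrow> space F" using measurable_space[OF f] spH by auto
      show ?thesis unfolding \<Lambda>X
      proof (rule D.cond_iid_dir)
        show "subalgebra P (generated_field P f F)"
          by (rule subalgebra_generated_field[OF measurable_from_subalg[OF D.subalgebra_H f]])
        show "sets (generated_field P f F) \<subseteq> sets H"
          using measurable_sets[OF f] spH by (auto simp: sets_generated_field[OF fs])
        show "(\<lambda>v. D.dir (\<Xi> v)) \<in> measurable (generated_field P f F) (prob_algebra (label_space L))"
          using measurable_compose[OF measurable_generated_field[OF fs] g] \<Lambda> \<Lambda>X by simp
      qed fact
    qed
    show ?thesis
    proof (intro conjI impI ballI \<Lambda>P \<Lambda>H)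
      show "\<Lambda>' X \<in> measurable E (prob_algebra (label_space L))"
        unfolding \<Lambda>'X by (rule D.measurable_dir)
      show "\<Lambda> X v = \<Lambda>' X (\<Xi> v)" for v by (simp add: \<Lambda>_def)
      show "AE v in P. real_cond_exp P H (indicator {v \<in> space P. v w \<in> B}) v = measure (\<Lambda> X v) B"
        if "w \<in> X" "B \<in> sets (label_space L)" for w B
        unfolding \<Lambda>X by (rule D.cond_marginal[OF that])
      show "AE v in P. \<Lambda> X (act W \<pi> v) = \<Lambda> X v" if "\<pi> \<in> G" for \<pi>
        unfolding \<Lambda>X by (rule D.dir_invariant[OF that \<open>finite L\<close>])
      assume X1: "infinite X \<or> card X = 1"
      show "cond_iid P (generated_field P (\<Lambda> X) (prob_algebra (label_space L))) (label_space L) X (\<Lambda> X)"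
        by (rule gen[OF X1 \<Lambda>H _ measurable_ident_sets[OF refl]]) simp
      show "cond_iid P (generated_field P \<Xi> E) (label_space L) X (\<Lambda> X)"
        by (rule gen[OF X1 D.\<Xi>_H \<Lambda>X D.measurable_dir])
      show "cond_iid P H (label_space L) X (\<Lambda> X)"
        unfolding \<Lambda>X
        by (rule D.cond_iid_dir[OF D.subalgebra_H order_refl X1 \<Lambda>H[unfolded \<Lambda>X]])
    qed
  qed
  show ?thesis
  proof (rule conjI, goal_cases)
    case 1
    show ?case by (rule exI[of _ \<Lambda>], rule exI[of _ \<Lambda>'], rule ballI, rule main)
  next
    case 2
    show ?case
      by (intro impI ballI, rule dependent_orbits_example[OF \<open>w0 \<in> W\<close> G])
        (assumption | erule orbits_subset orbits_nonempty)+
  qed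
qed

end
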